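(* The maximum utilitarian dumping paradox with $n$ players is $\Theta(\sqrt n)$: there exist constants $0<c\le C$ such that (i) for infinitely many $n$ there is an instance with $n$ players exhibiting a utilitarian $\alpha$-dumping paradox (for connected divisions) with $\alpha\ge c\sqrt n$, and (ii) for every $n$, every instance with $n$ players that exhibits a utilitarian $\alpha$-dumping paradox (for connected divisions) has $\alpha\le C\sqrt n$.
   Context: A cake is the interval $[0,1]$. There are $n$ players $1,\dots,n$; each player $i$ has a valuation $v_i$, a nonatomic countably additive probability measure on the Borel subsets of $[0,1]$. A (connected) division $x$ is a sequence $(X_1,\dots,X_n)$ of pairwise disjoint open intervals of $[0,1]$ (possibly empty), $X_i$ being the piece of player $i$; it is complete if the union of the closures of the $X_i$ equals $[0,1]$, and partial otherwise. Write $u_i(x,j)=v_i(X_j)$. $x$ is envy-free if $u_i(x,i)\ge u_i(x,j)$ for all $i,j$. Utilitarian welfare: $u(x)=\sum_i u_i(x,i)$. For a welfare function $w$ and $\alpha>1$, an instance exhibits an $\alpha$-dumping paradox with respect to $w$ if there exists an envy-free partial division $y$ such that $w(y)\ge \alpha\,w(x)$ for every envy-free complete division $x$. *)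

theory Defs
  imports "HOL-Probability.Probability"
begin

definition nonatomic :: "real measure \<Rightarrow> bool" where
  "nonatomic v \<longleftrightarrow> (\<forall>A\<in>sets v. emeasure v A > 0 \<longrightarrow>
      (\<exists>B\<in>sets v. B \<subseteq> A \<and> 0 < emeasure v B \<and> emeasure v B < emeasure v A))"

definition valuation :: "real measure \<Rightarrow> bool" where
  "valuation v \<longleftrightarrow> prob_space v \<and> sets v = sets (restrict_space borel {0..1})
      \<and> nonatomic v"

definition cake_instance :: "nat \<Rightarrow> (nat \<Rightarrow> real measure) \<Rightarrow> bool" where
  "cake_instance n v \<longleftrightarrow> (\<forall>i<n. valuation (v i))"

definition piece :: "(nat \<Rightarrow> real \<times> real) \<Rightarrow> nat \<Rightarrow> real set" where
  "piece x i = {fst (x i)<..<snd (x i)}"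

definition division :: "nat \<Rightarrow> (nat \<Rightarrow> real \<times> real) \<Rightarrow> bool" where
  "division n x \<longleftrightarrow> (\<forall>i<n. 0 \<le> fst (x i) \<and> fst (x i) \<le> snd (x i) \<and> snd (x i) \<le> 1)
     \<and> (\<forall>i<n. \<forall>j<n. i \<noteq> j \<longrightarrow> piece x i \<inter> piece x j = {})"

definition complete_div :: "nat \<Rightarrow> (nat \<Rightarrow> real \<times> real) \<Rightarrow> bool" where
  "complete_div n x \<longleftrightarrow> division n x \<and> (\<Union>i<n. closure (piece x i)) = {0..1}"

definition partial_div :: "nat \<Rightarrow> (nat \<Rightarrow> real \<times> real) \<Rightarrow> bool" where
  "partial_div n x \<longleftrightarrow> division n x \<and> \<not> (\<Union>i<n. closure (piece x i)) = {0..1}"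

definition util :: "(nat \<Rightarrow> real measure) \<Rightarrow> (nat \<Rightarrow> real \<times> real) \<Rightarrow> nat \<Rightarrow> nat \<Rightarrow> real" where
  "util v x i j = measure (v i) (piece x j)"

definition envy_free :: "nat \<Rightarrow> (nat \<Rightarrow> real measure) \<Rightarrow> (nat \<Rightarrow> real \<times> real) \<Rightarrow> bool" where
  "envy_free n v x \<longleftrightarrow> (\<forall>i<n. \<forall>j<n. util v x i i \<ge> util v x i j)"

definition utilitarian :: "nat \<Rightarrow> (nat \<Rightarrow> real measure) \<Rightarrow> (nat \<Rightarrow> real \<times> real) \<Rightarrow> real" where
  "utilitarian n v x = (\<Sum>i<n. util v x i i)"

definition utilitarian_dumping :: "nat \<Rightarrow> (nat \<Rightarrow> real measure) \<Rightarrow> real \<Rightarrow> bool" where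
  "utilitarian_dumping n v \<alpha> \<longleftrightarrow> \<alpha> > 1 \<and>
     (\<exists>y. partial_div n y \<and> envy_free n v y \<and>
        (\<forall>x. complete_div n x \<and> envy_free n v x \<longrightarrow> utilitarian n v y \<ge> \<alpha> * utilitarian n v x))"

end

theory Submission
  imports Defs
begin

text \<open>
  Upper bound. An envy-free complete division \<open>x\<close> exists: parametrise divisions by stick-breaking, so
  that the \<open>j\<close>-th coordinate of a point of the cube is the fraction of the remaining cake cut off as
  piece \<open>j\<close>, and label a grid point by the favourite piece of the player owning it. An empty piece is
  never a favourite, which is exactly the boundary condition of Kuhn's lemma, and the vertices of a
  Kuhn simplex have consecutive coordinate sums, so they can be owned by distinct players. In \<open>x\<close>
  every player gets at least \<open>1/n\<close>. If the piece of player \<open>i\<close> in \<open>y\<close> meets \<open>k i\<close> pieces of \<open>x\<close>, its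
  value is at most both \<open>1\<close> and \<open>k i\<close> times the value \<open>i\<close> gets in \<open>x\<close>. Since the numbers \<open>k i\<close> add up
  to at most \<open>2n\<close>, Cauchy--Schwarz gives the bound \<open>sqrt (2n)\<close> for the ratio.

  Lower bound. Measure the cake in units, with \<open>M = m^2\<close>. It consists of \<open>M\<close> groups of length 40, a
  stretch of length \<open>M\<close> to be dumped, and a reserved part of \<open>M\<close> unit cells split into \<open>m\<close> runs of
  \<open>m\<close> cells. There are \<open>20M\<close> identical common players (uniform on groups and dump), 20 players for
  each group, and \<open>m\<close> rich players, each uniform on one run. A group player sees density 1 on groups and
  dump, 9 more on its own group, 40 clusters of mass 30 at the two ends of every second unit interval
  of that group, and mass 65 on one cell. Giving each group player an interval with two clusters, each
  common player an interval in between and each rich player its run is envy-free with welfare at least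
  \<open>m\<close>. In an envy-free complete division the dump has to be absorbed. All common pieces then have the
  same length \<open>w > 1\<close>, so every common piece in a group swallows a cluster. At most
  one player of each group can settle for its cell and the others need about unit length, which keeps
  \<open>w\<close> close to 1. If a rich piece contained the cell of a group, the 20 players of that group would all
  insist on 65, leaving clusters for few common pieces, and the group could not be covered by pieces of
  length at most \<open>w\<close>. So a rich piece contains no full cell, hence is worth at most \<open>2/m\<close> to its owner,
  and the welfare is bounded.
\<close>

section \<open>Valuations and distribution functions\<close>

definition vcdf :: "real measure \<Rightarrow> real \<Rightarrow> real" where
  "vcdf v t = measure v ({..t} \<inter> {0..1})"

lemma valuation_sets:
  assumes "valuation v" "A \<in> sets borel"
  shows "A \<inter> {0..1} \<in> sets v"
  using assms by (auto simp: valuation_def sets_restrict_space)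

lemma valuation_space: "valuation v \<Longrightarrow> space v = {0..1}"
  unfolding valuation_def using sets_eq_imp_space_eq[of v "restrict_space borel {0..1}"]
  by (simp add: space_restrict_space)

text \<open>A point of positive mass would have no subset of strictly intermediate measure.\<close>

lemma valuation_singleton:
  assumes "valuation v"
  shows "measure v ({x} \<inter> {0..1}) = 0"
proof (rule ccontr)
  assume "measure v ({x} \<inter> {0..1}) \<noteq> 0"
  then have "emeasure v ({x} \<inter> {0..1}) > 0"
    by (simp add: measure_def zero_less_iff_neq_zero) (metis enn2real_0)
  moreover have "{x} \<inter> {0..1} \<in> sets v"
    using assms by (intro valuation_sets) auto
  ultimately obtain B where B: "B \<subseteq> {x} \<inter> {0..1}" "0 < emeasure v B"
      "emeasure v B < emeasure v ({x} \<inter> {0..1})"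
    using assms unfolding valuation_def nonatomic_def by blast
  then have "B = {} \<or> B = {x} \<inter> {0..1}"
    by auto
  with B show False
    by auto
qed

text \<open>Pushing \<open>v\<close> forward to the Borel sets of the line makes
  \<open>vcdf v\<close> a genuine \<open>cdf\<close>, whose continuity is the vanishing of
  singletons.\<close>

lemma
  assumes "valuation v"
  shows continuous_vcdf: "continuous_on UNIV (vcdf v)"
    and mono_vcdf: "mono (vcdf v)"
    and vcdf_0: "vcdf v 0 = 0"
    and vcdf_1: "vcdf v 1 = 1"
    and measure_vcdf: "\<And>l r. 0 \<le> l \<Longrightarrow> l \<le> r \<Longrightarrow> r \<le> 1 \<Longrightarrow> measure v {l<..<r} = vcdf v r - vcdf v l"
proof -
  interpret prob_space v
    using assms by (simp add: valuation_def)
  have m: "(\<lambda>x. x) \<in> v \<rightarrow>\<^sub>M borel"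
    using assms by (auto simp: measurable_def valuation_space valuation_sets)
  define M where "M = distr v borel (\<lambda>x. x)"
  interpret M: real_distribution M
    unfolding M_def by (intro real_distribution_distr m)
  have M: "measure M A = measure v (A \<inter> {0..1})" if "A \<in> sets borel" for A
    using that m assms by (simp add: M_def measure_distr valuation_space)
  have cdf: "vcdf v = cdf M"
    by (simp add: fun_eq_iff vcdf_def cdf_def M)
  show "continuous_on UNIV (vcdf v)"
    by (simp add: cdf continuous_on_eq_continuous_at M.isCont_cdf M valuation_singleton[OF assms])
  show "mono (vcdf v)"
    by (simp add: cdf mono_def M.cdf_nondecreasing)
  have "{..0} \<inter> {0..1} = {0::real} \<inter> {0..1}"
    by auto
  then show "vcdf v 0 = 0"
    using valuation_singleton[OF assms, of 0] by (simp add: vcdf_def)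
  have "{..1} \<inter> {0..1} = {0..1::real}"
    by auto
  then show "vcdf v 1 = 1"
    using prob_space by (simp add: vcdf_def valuation_space[OF assms])
  fix l r :: real
  assume lr: "0 \<le> l" "l \<le> r" "r \<le> 1"
  have "measure M {l<..r} = vcdf v r - vcdf v l"
    using lr M.cdf_diff_eq[of l r] by (cases "l = r") (auto simp: cdf)
  moreover have "measure M {l<..<r} = measure M {l<..r}"
  proof (cases "l = r")
    case False
    then have "{l<..r} = {l<..<r} \<union> {r}"
      using lr by auto
    then have "measure M {l<..r} = measure M {l<..<r} + measure M {r}"
      by (simp only:) (rule M.finite_measure_Union; auto)
    then show ?thesis
      by (simp add: M[of "{r}"] valuation_singleton[OF assms])
  qed simp
  moreover have "{l<..<r} \<inter> {0..1} = {l<..<r}"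
    using lr by auto
  ultimately show "measure v {l<..<r} = vcdf v r - vcdf v l"
    by (simp add: M)
qed

lemma util_vcdf:
  assumes "cake_instance n v" "division n x" "i < n" "j < n"
  shows "util v x i j = vcdf (v i) (snd (x j)) - vcdf (v i) (fst (x j))"
  using assms unfolding util_def piece_def cake_instance_def division_def
  by (intro measure_vcdf) auto

section \<open>Interval measures of continuous monotone functions\<close>

lemma emeasure_interval_measure_Ioo:
  fixes F :: "real \<Rightarrow> real"
  assumes "continuous_on UNIV F" "mono F" "a \<le> b"
  shows "emeasure (interval_measure F) {a<..<b} = F b - F a"
proof (cases "a = b")
  case False
  have mono: "\<And>x y. x \<le> y \<Longrightarrow> F x \<le> F y" and cont: "\<And>x. continuous (at_right x) F"
    using assms by (auto simp: mono_def continuous_on_eq_continuous_at continuous_at_imp_continuous_within)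
  have *: "emeasure (interval_measure F) {b} = 0"
    using emeasure_interval_measure_Icc[of b b F] mono assms by (simp add: continuous_on_subset)
  have "emeasure (interval_measure F) {a<..b} = emeasure (interval_measure F) ({a<..<b} \<union> {b})"
    using False assms by (intro arg_cong[where f="emeasure _"]) auto
  also have "\<dots> = emeasure (interval_measure F) {a<..<b} + emeasure (interval_measure F) {b}"
    by (rule plus_emeasure[symmetric]) auto
  finally show ?thesis
    using * emeasure_interval_measure_Ioc[of a b F] mono cont assms by simp
qed simp

text \<open>Disjoint open pieces inside the cake give \<le>, closed pieces covering it give \<ge>,
  and for continuous \<open>F\<close> the endpoints weigh nothing. With arbitrary \<open>F\<close>
  the identity also applies to a valuation restricted to an interval and, in the lower bound, to
  each part of a density.\<close>

lemma complete_div_sum_eq: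
  fixes F :: "real \<Rightarrow> real"
  assumes F: "continuous_on UNIV F" "mono F" and x: "complete_div n x"
  shows "(\<Sum>i<n. F (snd (x i)) - F (fst (x i))) = F 1 - F 0"
proof -
  let ?M = "interval_measure F"
  have mono: "\<And>x y. x \<le> y \<Longrightarrow> F x \<le> F y"
    using assms by (auto simp: mono_def)
  have Icc: "emeasure ?M {a..b} = F b - F a" if "a \<le> b" for a b
    using that mono F(1) by (intro emeasure_interval_measure_Icc) (auto simp: continuous_on_subset)
  have d: "division n x"
    using x by (simp add: complete_div_def)
  show ?thesis
  proof (rule antisym)
    have "ennreal (\<Sum>i<n. F (snd (x i)) - F (fst (x i))) = (\<Sum>i<n. ennreal (F (snd (x i)) - F (fst (x i))))"
      using d mono by (intro sum_ennreal[symmetric]) (auto simp: division_def)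
    also have "\<dots> = (\<Sum>i<n. emeasure ?M (piece x i))"
      using d by (intro sum.cong) (auto simp: division_def piece_def emeasure_interval_measure_Ioo[OF F])
    also have "\<dots> = emeasure ?M (\<Union>i<n. piece x i)"
      using d by (intro sum_emeasure) (auto simp: division_def disjoint_family_on_def piece_def)
    also have "\<dots> \<le> emeasure ?M {0..1}"
      using d by (intro emeasure_mono) (fastforce simp: division_def piece_def)+
    finally show "(\<Sum>i<n. F (snd (x i)) - F (fst (x i))) \<le> F 1 - F 0"
      using mono[of 0 1] by (simp add: Icc ennreal_le_iff)
    have "closure (piece x i) \<subseteq> {fst (x i)..snd (x i)}" for i
      by (intro closure_minimal) (auto simp: piece_def)
    then have "(\<Union>i<n. closure (piece x i)) \<subseteq> (\<Union>i<n. {fst (x i)..snd (x i)})"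
      by blast
    then have "{0..1} \<subseteq> (\<Union>i<n. {fst (x i)..snd (x i)})"
      using x by (simp add: complete_div_def)
    then have "emeasure ?M {0..1} \<le> emeasure ?M (\<Union>i<n. {fst (x i)..snd (x i)})"
      by (intro emeasure_mono) auto
    also have "\<dots> \<le> (\<Sum>i<n. emeasure ?M {fst (x i)..snd (x i)})"
      by (intro emeasure_subadditive_finite) auto
    also have "\<dots> = (\<Sum>i<n. ennreal (F (snd (x i)) - F (fst (x i))))"
      using d by (intro sum.cong) (auto simp: division_def Icc)
    also have "\<dots> = ennreal (\<Sum>i<n. F (snd (x i)) - F (fst (x i)))"
      using d mono by (intro sum_ennreal) (auto simp: division_def)
    finally have "ennreal (F 1 - F 0) \<le> ennreal (\<Sum>i<n. F (snd (x i)) - F (fst (x i)))"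
      by (simp add: Icc)
    then show "F 1 - F 0 \<le> (\<Sum>i<n. F (snd (x i)) - F (fst (x i)))"
      using d mono Icc[of 0 1] by (subst (asm) ennreal_le_iff) (auto intro!: sum_nonneg simp: division_def Icc)
  qed
qed

definition cdf_measure :: "(real \<Rightarrow> real) \<Rightarrow> real measure" where
  "cdf_measure F = restrict_space (interval_measure F) {0..1}"

lemma
  fixes F :: "real \<Rightarrow> real"
  assumes F: "continuous_on UNIV F" "mono F"
  shows measure_cdf_measure:
      "\<And>l r. 0 \<le> l \<Longrightarrow> l \<le> r \<Longrightarrow> r \<le> 1 \<Longrightarrow> measure (cdf_measure F) {l<..<r} = F r - F l"
    and valuation_cdf_measure: "F 0 = 0 \<Longrightarrow> F 1 = 1 \<Longrightarrow> valuation (cdf_measure F)"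
proof -
  let ?M = "interval_measure F"
  have mono: "\<And>x y. x \<le> y \<Longrightarrow> F x \<le> F y"
    using assms by (auto simp: mono_def)
  have Icc: "emeasure ?M {a..b} = F b - F a" if "a \<le> b" for a b
    using that mono F(1) by (intro emeasure_interval_measure_Icc) (auto simp: continuous_on_subset)
  have restr: "emeasure (cdf_measure F) A = emeasure ?M A" if "A \<subseteq> {0..1}" for A
    using that unfolding cdf_measure_def by (intro emeasure_restrict_space) auto
  show "measure (cdf_measure F) {l<..<r} = F r - F l" if "0 \<le> l" "l \<le> r" "r \<le> 1" for l r
  proof -
    have "{l<..<r} \<subseteq> {0..1}"
      using that by auto
    with that mono show ?thesis
      by (simp add: measure_def restr emeasure_interval_measure_Ioo[OF F])
  qed
  assume 01: "F 0 = 0" "F 1 = 1"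
  have space: "space (cdf_measure F) = {0..1}"
    by (simp add: cdf_measure_def space_restrict_space)
  interpret prob_space "cdf_measure F"
    by (rule prob_spaceI) (simp add: space restr Icc 01)
  have sets: "sets (cdf_measure F) = sets (restrict_space borel {0..1})"
    unfolding cdf_measure_def by (intro sets_restrict_space_cong) simp
  have "nonatomic (cdf_measure F)"
    unfolding nonatomic_def
  proof (intro ballI impI)
    fix A
    assume A: "A \<in> sets (cdf_measure F)" and pos: "emeasure (cdf_measure F) A > 0"
    \<comment> \<open>Cutting \<open>A\<close> at \<open>t\<close> makes \<open>g\<close> vary by no
      more than \<open>F\<close>, hence continuously from \<open>0\<close> to the measure of
      \<open>A\<close>; the cut at half of it gives the intermediate subset.\<close>
    define g where "g t = measure (cdf_measure F) (A \<inter> {..t})" for t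
    have A01: "A \<subseteq> {0..1}"
      using sets.sets_into_space[OF A] space by simp
    have cut: "A \<inter> B \<in> sets (cdf_measure F)" if "B \<in> sets borel" for B
    proof -
      have "{0..1} \<inter> B \<in> sets (cdf_measure F)"
        using that by (auto simp: sets sets_restrict_space)
      then have "A \<inter> ({0..1} \<inter> B) \<in> sets (cdf_measure F)"
        using A by (rule sets.Int[rotated])
      moreover have "A \<inter> ({0..1} \<inter> B) = A \<inter> B"
        using A01 by auto
      ultimately show ?thesis
        by simp
    qed
    have g_step: "\<bar>g t - g s\<bar> \<le> F t - F s" if "s \<le> t" for s t
    proof -
      have "A \<inter> {..t} = (A \<inter> {..s}) \<union> (A \<inter> {s<..t})"
        using that by auto
      then have "g t = g s + measure (cdf_measure F) (A \<inter> {s<..t})"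
        unfolding g_def by (simp only:) (rule finite_measure_Union; auto intro: cut)
      moreover have "emeasure (cdf_measure F) (A \<inter> {s<..t}) \<le> emeasure ?M {s..t}"
        using A01 by (subst restr) (auto intro!: emeasure_mono)
      ultimately show ?thesis
        using that mono[of s t] by (simp add: Icc emeasure_eq_measure ennreal_le_iff)
    qed
    have "continuous_on {0..1} g"
    proof (rule continuous_onI)
      fix t e :: real
      assume "0 < e" "t \<in> {0..1}"
      then obtain d where d: "d > 0" "\<And>s. dist s t < d \<Longrightarrow> dist (F s) (F t) < e"
        using F(1) unfolding continuous_on_iff by blast
      have "dist (g s) (g t) \<le> e" if "dist s t < d" for s
        using d(2)[OF that] g_step[of s t] g_step[of t s] by (cases "s \<le> t") (auto simp: dist_real_def)
      then show "\<exists>d>0. \<forall>s\<in>{0..1}. dist s t < d \<longrightarrow> dist (g s) (g t) \<le> e"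
        using d(1) by blast
    qed
    moreover have "g 0 = 0"
    proof -
      have "emeasure (cdf_measure F) (A \<inter> {..0}) \<le> emeasure ?M {0..0}"
        using A01 by (subst restr) (auto intro!: emeasure_mono)
      then show ?thesis
        using Icc[of 0 0] by (simp add: g_def measure_def)
    qed
    moreover have g1: "g 1 = measure (cdf_measure F) A"
      using A01 unfolding g_def by (intro arg_cong[where f="measure _"]) auto
    moreover have posm: "measure (cdf_measure F) A > 0"
      using pos by (simp add: emeasure_eq_measure)
    ultimately obtain t where "g t = measure (cdf_measure F) A / 2"
      using IVT'[of g 0 "measure (cdf_measure F) A / 2" 1] by auto
    then have "0 < emeasure (cdf_measure F) (A \<inter> {..t})"
        "emeasure (cdf_measure F) (A \<inter> {..t}) < emeasure (cdf_measure F) A"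
      using posm by (auto simp: g_def emeasure_eq_measure ennreal_less_iff)
    then show "\<exists>B\<in>sets (cdf_measure F). B \<subseteq> A \<and> 0 < emeasure (cdf_measure F) B \<and>
        emeasure (cdf_measure F) B < emeasure (cdf_measure F) A"
      using cut[of "{..t}"] by auto
  qed
  then show "valuation (cdf_measure F)"
    unfolding valuation_def using prob_space_axioms sets by auto
qed

section \<open>Existence of envy-free complete divisions\<close>

lemma finite_surj_imp_bij:
  assumes "finite A" "f ` A = A"
  shows "bij_betw f A A"
  using assms by (simp add: bij_betw_def eq_card_imp_inj_on)

text \<open>\<open>kuhn_combinatorial\<close> yields a simplex showing all labels. Its vertices
  \<open>enum t\<close> have coordinate sums increasing by one, so the sum modulo
  \<open>Suc N\<close> gives each of the \<open>N + 1\<close> players exactly one vertex, labelled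
  by that player.\<close>

lemma kuhn_owned_vertices:
  fixes lbl :: "nat \<Rightarrow> (nat \<Rightarrow> nat) \<Rightarrow> nat"
  assumes p: "0 < p"
    and le: "\<And>i z. lbl i z \<le> N"
    and zero: "\<And>i z j. (\<And>j. z j \<le> p) \<Longrightarrow> j < N \<Longrightarrow> z j = 0 \<Longrightarrow> lbl i z \<noteq> j"
    and top: "\<And>i z j. (\<And>j. z j \<le> p) \<Longrightarrow> j < N \<Longrightarrow> z j = p \<Longrightarrow> lbl i z \<le> j"
  obtains base z where "\<And>i j. i \<le> N \<Longrightarrow> base j \<le> z i j \<and> z i j \<le> Suc (base j)"
    and "\<And>i j. i \<le> N \<Longrightarrow> z i j \<le> p"
    and "\<And>i j. i \<le> N \<Longrightarrow> N \<le> j \<Longrightarrow> z i j = p"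
    and "bij_betw (\<lambda>i. lbl i (z i)) {..N} {..N}"
proof -
  define owner where "owner z = (\<Sum>j<N. z j) mod Suc N" for z :: "nat \<Rightarrow> nat"
  define L where "L z = lbl (owner z) z" for z
  \<comment> \<open>Zero before position \<open>L z\<close> and nonzero there, so that
    \<open>reduced\<close> recovers \<open>L z\<close>. Kuhn's lemma demands the value 0 at every
    zero coordinate; \<open>zero\<close> guarantees that \<open>L z < N\<close> is not one of
    them.\<close>
  define lab where "lab z j = (if j < L z \<or> z j = 0 then 0 else 1::nat)" for z j
  have red: "reduced N (lab z) = L z" if "\<And>j. z j \<le> p" for z
  proof (rule reduced_labelling_unique)
    show "L z = N \<or> lab z (L z) \<noteq> 0"
      using zero[of z "L z" "owner z"] le[of "owner z" z] that
      by (auto simp: lab_def L_def le_less)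
  qed (auto simp: lab_def L_def le)
  have "odd (card {s. ksimplex p N s \<and> (reduced N \<circ> lab) ` s = {..N}})"
  proof (rule kuhn_combinatorial[OF p])
    show "\<forall>z j. (\<forall>j. z j \<le> p) \<and> j < N \<and> z j = p \<longrightarrow> lab z j = 1"
    proof (intro allI impI)
      fix z j
      assume "(\<forall>j. z j \<le> p) \<and> j < N \<and> z j = p"
      then show "lab z j = 1"
        using top[of z j "owner z"] p by (auto simp: lab_def L_def not_less)
    qed
  qed (auto simp: lab_def)
  then have "{s. ksimplex p N s \<and> (reduced N \<circ> lab) ` s = {..N}} \<noteq> {}"
    by (rule odd_card_imp_not_empty)
  then obtain s b u where "kuhn_simplex p N b u s" and rl: "(reduced N \<circ> lab) ` s = {..N}"
    by (auto elim: ksimplex.cases)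
  interpret kuhn_simplex p N b u s by fact
  have bound: "enum t j \<le> p" if "t \<le> N" for t j
    using s_le_p enum_in that by blast
  have sum: "(\<Sum>j<N. enum t j) = (\<Sum>j<N. b j) + t" if "t \<le> N" for t
    using that
  proof (induction t)
    case (Suc t)
    then have "(\<Sum>j<N. enum (Suc t) j) = (\<Sum>j<N. enum t j + (if j = u t then 1 else 0))"
      by (intro sum.cong) (auto simp: enum_Suc)
    also have "\<dots> = (\<Sum>j<N. enum t j) + 1"
      using Suc.prems upd_space[of t] by (simp add: sum.distrib)
    finally show ?case
      using Suc by simp
  qed (simp add: enum_0)
  have "inj_on (\<lambda>t. owner (enum t)) {..N}"
  proof (rule inj_onI)
    fix t t'
    assume t: "t \<in> {..N}" "t' \<in> {..N}" and eq: "owner (enum t) = owner (enum t')"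
    have le: "t1 = t2" if "t1 \<le> t2" "t2 \<le> N" "((\<Sum>j<N. b j) + t1) mod Suc N = ((\<Sum>j<N. b j) + t2) mod Suc N"
      for t1 t2
    proof -
      have "Suc N dvd t2 - t1"
        using that mod_eq_dvd_iff_nat[of "(\<Sum>j<N. b j) + t1" "(\<Sum>j<N. b j) + t2" "Suc N"] by simp
      then show ?thesis
        using that nat_dvd_not_less[of "t2 - t1" "Suc N"] by (cases "t1 < t2") auto
    qed
    show "t = t'"
      using le[of t t'] le[of t' t] t eq by (cases "t \<le> t'") (auto simp: owner_def sum)
  qed
  moreover have "(\<lambda>t. owner (enum t)) ` {..N} \<subseteq> {..N}"
    by (auto simp: owner_def less_Suc_eq_le[symmetric])
  ultimately have owner: "bij_betw (\<lambda>t. owner (enum t)) {..N} {..N}"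
    by (metis bij_betw_def card_image card_subset_eq finite_atMost)
  define w where "w = inv_into {..N} (\<lambda>t. owner (enum t))"
  have w: "bij_betw w {..N} {..N}" "\<And>i. i \<le> N \<Longrightarrow> owner (enum (w i)) = i"
    using bij_betw_inv_into[OF owner] bij_betw_inv_into_right[OF owner] by (auto simp: w_def)
  have wN: "w i \<le> N" if "i \<le> N" for i
    using bij_betwE[OF w(1)] that by auto
  have "(\<lambda>i. lbl i (enum (w i))) ` {..N} = L ` enum ` w ` {..N}"
    using w(2) by (auto simp: L_def image_image)
  also have "\<dots> = L ` s"
    using w(1) by (simp add: bij_betw_def s_eq)
  also have "\<dots> = {..N}"
    using rl red s_le_p by (simp add: image_image cong: image_cong)
  finally have "bij_betw (\<lambda>i. lbl i (enum (w i))) {..N} {..N}"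
    by (intro finite_surj_imp_bij) auto
  with wN show thesis
    by (intro that[of b "\<lambda>i. enum (w i)"])
      (auto simp: bound base_le le_Suc_base enum_in enum_eq_p)
qed

section \<open>Stick-breaking and approximately envy-free cuts\<close>

primrec cut :: "(nat \<Rightarrow> real) \<Rightarrow> nat \<Rightarrow> real" where
  "cut y 0 = 0"
| "cut y (Suc j) = cut y j + y j * (1 - cut y j)"

lemma cut_bounds:
  assumes "\<And>j. y j \<in> {0..1}"
  shows "cut y j \<in> {0..1} \<and> cut y j \<le> cut y (Suc j)"
proof (induction j)
  case (Suc j)
  then have *: "0 \<le> cut y (Suc j)" "cut y j \<le> 1" "0 \<le> y j" "y j \<le> 1"
    using assms[of j] by auto
  have "y j * (1 - cut y j) \<le> 1 * (1 - cut y j)"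
    using * by (intro mult_right_mono) auto
  then have "cut y (Suc j) \<le> 1"
    by simp
  then show ?case
    using * assms[of "Suc j"] by simp
qed (use assms[of 0] in auto)

lemma cut_eq_1:
  assumes "y j = 1" "j < k"
  shows "cut y k = 1"
proof -
  have "cut y (Suc j + d) = 1" for d
    using assms by (induction d) auto
  from this[of "k - Suc j"] show ?thesis
    using assms by simp
qed

lemma tendsto_cut:
  assumes "\<And>j. (\<lambda>k. y k j) \<longlonglongrightarrow> z j"
  shows "(\<lambda>k. cut (y k) j) \<longlonglongrightarrow> cut z j"
  by (induction j) (auto intro!: tendsto_intros assms)

text \<open>Each player judges the division at its own vertex \<open>y i\<close> of one small
  simplex, so this is not yet a common division; the distance \<open>1 / p\<close> to
  \<open>base\<close> makes the vertices merge as \<open>p\<close> grows.\<close>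

lemma approx_envy_free_cuts:
  fixes F :: "nat \<Rightarrow> real \<Rightarrow> real"
  assumes F01: "\<And>i. i \<le> N \<Longrightarrow> F i 0 < F i 1"
    and p: "0 < p"
  obtains base y \<pi> where "\<And>i j. i \<le> N \<Longrightarrow> \<bar>y i j - base j\<bar> \<le> 1 / real p"
    and "\<And>j. base j \<in> {0..1}" and "\<And>i j. i \<le> N \<Longrightarrow> y i j \<in> {0..1}"
    and "\<And>i j. i \<le> N \<Longrightarrow> N \<le> j \<Longrightarrow> y i j = 1"
    and "bij_betw \<pi> {..N} {..N}"
    and "\<And>i j. i \<le> N \<Longrightarrow> j \<le> N \<Longrightarrow>
      F i (cut (y i) (Suc j)) - F i (cut (y i) j) \<le> F i (cut (y i) (Suc (\<pi> i))) - F i (cut (y i) (\<pi> i))"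
proof -
  \<comment> \<open>All coordinates from \<open>N\<close> on are \<open>1\<close>, so that piece \<open>N\<close> takes the whole rest of the cake.\<close>
  define sc where "sc z j = (if N \<le> j then 1 else real (z j) / real p)" for z :: "nat \<Rightarrow> nat" and j
  define val where "val i z j = F i (cut (sc z) (Suc j)) - F i (cut (sc z) j)" for i z j
  \<comment> \<open>Indices \<open>i > N\<close> are no players; they get some label obeying the boundary conditions.\<close>
  define lbl where "lbl i z = (SOME j. j \<le> N \<and> (i \<le> N \<longrightarrow> (\<forall>j'\<le>N. val i z j' \<le> val i z j))
      \<and> ((\<forall>j. z j \<le> p) \<longrightarrow> (j < N \<longrightarrow> z j \<noteq> 0) \<and> (\<forall>j'<N. z j' = p \<longrightarrow> j \<le> j')))"
    for i z
  have sc: "sc z j \<in> {0..1}" if "\<And>j. z j \<le> p" for z j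
    using that p by (auto simp: sc_def)
  have ex: "\<exists>j. j \<le> N \<and> (i \<le> N \<longrightarrow> (\<forall>j'\<le>N. val i z j' \<le> val i z j))
      \<and> ((\<forall>j. z j \<le> p) \<longrightarrow> (j < N \<longrightarrow> z j \<noteq> 0) \<and> (\<forall>j'<N. z j' = p \<longrightarrow> j \<le> j'))" (is "\<exists>j. ?P j")
    for i z
  proof (cases "i \<le> N")
    case True
    define m where "m = Max (val i z ` {..N})"
    have "m \<in> val i z ` {..N}"
      unfolding m_def by (intro Max_in) auto
    then obtain j where j: "j \<le> N" "val i z j = m"
      by auto
    have max: "val i z j' \<le> val i z j" if "j' \<le> N" for j'
      using that by (simp add: j m_def)
    have "(j < N \<longrightarrow> z j \<noteq> 0) \<and> (\<forall>j'<N. z j' = p \<longrightarrow> j \<le> j')" if z: "\<forall>j. z j \<le> p"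
    proof -
      \<comment> \<open>The values telescope to a positive total, so a favourite piece has distinct
        endpoints. Coordinate \<open>0\<close> would make it empty, and after a coordinate
        \<open>p\<close> nothing is left to cut.\<close>
      have "(\<Sum>j\<le>N. val i z j) = F i (cut (sc z) (Suc N)) - F i (cut (sc z) 0)"
        unfolding val_def lessThan_Suc_atMost[symmetric] by (rule sum_lessThan_telescope)
      also have "\<dots> = F i 1 - F i 0"
        using cut_eq_1[of "sc z" N "Suc N"] by (simp add: sc_def del: cut.simps(2))
      also have "\<dots> > 0"
        using F01[OF True] by simp
      finally have "0 < val i z j"
        using max sum_nonpos[of "{..N}" "val i z"] by (smt (verit) atMost_iff)
      then have lt: "cut (sc z) j \<noteq> cut (sc z) (Suc j)"
        by (auto simp: val_def)
      then have "sc z j \<noteq> 0"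
        by auto
      then have "j < N \<longrightarrow> z j \<noteq> 0"
        by (auto simp: sc_def)
      moreover have "j \<le> j'" if "j' < N" "z j' = p" for j'
      proof (rule ccontr)
        assume "\<not> j \<le> j'"
        moreover have "sc z j' = 1"
          using that p by (simp add: sc_def)
        ultimately have "cut (sc z) j = 1" "cut (sc z) (Suc j) = 1"
          using cut_eq_1[of "sc z" j'] by auto
        with lt show False
          by simp
      qed
      ultimately show ?thesis
        by blast
    qed
    with j max have "?P j"
      by blast
    then show ?thesis ..
  next
    case False
    show ?thesis
    proof (cases "\<exists>j'<N. z j' = p")
      case True
      \<comment> \<open>Without preferences, the first coordinate equal to \<open>p\<close> obeys
        both boundary conditions; if there is none, \<open>N\<close> does.\<close>
      define j where "j = (LEAST j'. j' < N \<and> z j' = p)"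
      have "j < N" "z j = p"
        using LeastI_ex[OF True[unfolded Bex_def]] by (auto simp: j_def)
      moreover have "j \<le> j'" if "j' < N" "z j' = p" for j'
        unfolding j_def using that by (intro Least_le) auto
      ultimately show ?thesis
        using False p by (intro exI[of _ j]) auto
    next
      case nex: False
      with False show ?thesis
        by (intro exI[of _ N]) auto
    qed
  qed
  have lbl: "lbl i z \<le> N \<and> (i \<le> N \<longrightarrow> (\<forall>j'\<le>N. val i z j' \<le> val i z (lbl i z)))
      \<and> ((\<forall>j. z j \<le> p) \<longrightarrow> (lbl i z < N \<longrightarrow> z (lbl i z) \<noteq> 0) \<and> (\<forall>j'<N. z j' = p \<longrightarrow> lbl i z \<le> j'))"
    for i z
    unfolding lbl_def by (rule someI_ex[OF ex])
  obtain b z where b: "\<And>i j. i \<le> N \<Longrightarrow> b j \<le> z i j \<and> z i j \<le> Suc (b j)"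
    and z: "\<And>i j. i \<le> N \<Longrightarrow> z i j \<le> p"
    and bij: "bij_betw (\<lambda>i. lbl i (z i)) {..N} {..N}"
    using lbl by (rule_tac kuhn_owned_vertices[of p lbl N, OF p]) (blast+)
  have bp: "b j \<le> p" for j
    using b[of 0 j] z[of 0 j] by simp
  show thesis
  proof (rule that)
    fix i j assume i: "i \<le> N"
    have "\<bar>real (z i j) - real (b j)\<bar> \<le> 1"
      using b[OF i, of j] by linarith
    then show "\<bar>sc (z i) j - sc b j\<bar> \<le> 1 / real p"
      using p by (auto simp: sc_def diff_divide_distrib[symmetric] abs_divide divide_right_mono)
  next
    show "bij_betw (\<lambda>i. lbl i (z i)) {..N} {..N}" by (fact bij)
    show "F i (cut (sc (z i)) (Suc j)) - F i (cut (sc (z i)) j)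
        \<le> F i (cut (sc (z i)) (Suc (lbl i (z i)))) - F i (cut (sc (z i)) (lbl i (z i)))"
      if "i \<le> N" "j \<le> N" for i j
      using lbl[of i "z i"] that unfolding val_def by blast
  qed (use sc bp z in \<open>auto simp: sc_def\<close>)
qed

section \<open>Passage to the limit\<close>

lemma convergent_subsequence_coordinates:
  fixes f :: "nat \<Rightarrow> nat \<Rightarrow> real"
  assumes "\<And>k j. f k j \<in> {0..1}"
  shows "\<exists>r. strict_mono r \<and> (\<forall>j<N. convergent (\<lambda>k. f (r k) j))"
proof (induction N)
  case 0
  show ?case
    by (rule exI[of _ id]) (simp add: strict_mono_def)
next
  case (Suc N)
  then obtain r where r: "strict_mono r" "\<And>j. j < N \<Longrightarrow> convergent (\<lambda>k. f (r k) j)"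
    by blast
  obtain l s where s: "strict_mono s" "((\<lambda>k. f (r k) N) \<circ> s) \<longlonglongrightarrow> l"
    using assms compact_Icc[of 0 "1::real"] unfolding compact_def
    by (metis (no_types, lifting))
  have "convergent (\<lambda>k. f (r (s k)) j)" if "j < Suc N" for j
  proof (cases "j = N")
    case False
    then show ?thesis
      using that convergent_subseq_convergent[OF r(2) s(1), of j] by (simp add: o_def)
  qed (use s(2) in \<open>auto simp: o_def convergent_def\<close>)
  then show ?case
    using strict_mono_o[OF r(1) s(1)] by (intro exI[of _ "r \<circ> s"]) (auto simp: o_def)
qed

lemma envy_free_cuts:
  fixes F :: "nat \<Rightarrow> real \<Rightarrow> real"
  assumes F01: "\<And>i. i \<le> N \<Longrightarrow> F i 0 < F i 1"
    and cont: "\<And>i. i \<le> N \<Longrightarrow> continuous_on UNIV (F i)"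
  obtains y \<pi> where "\<And>j. y j \<in> {0..1}" and "y N = 1" and "bij_betw \<pi> {..N} {..N}"
    and "\<And>i j. i \<le> N \<Longrightarrow> j \<le> N \<Longrightarrow>
      F i (cut y (Suc j)) - F i (cut y j) \<le> F i (cut y (Suc (\<pi> i))) - F i (cut y (\<pi> i))"
proof -
  have "\<exists>base y \<pi>. (\<forall>i j. i \<le> N \<longrightarrow> \<bar>y i j - base j\<bar> \<le> 1 / real (Suc k)) \<and>
      (\<forall>j. base j \<in> {0..1}) \<and> (\<forall>i j. i \<le> N \<longrightarrow> y i j \<in> {0..1}) \<and>
      (\<forall>i j. i \<le> N \<longrightarrow> N \<le> j \<longrightarrow> y i j = 1) \<and> bij_betw \<pi> {..N} {..N} \<and>
      (\<forall>i j. i \<le> N \<longrightarrow> j \<le> N \<longrightarrow>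
        F i (cut (y i) (Suc j)) - F i (cut (y i) j) \<le> F i (cut (y i) (Suc (\<pi> i))) - F i (cut (y i) (\<pi> i)))"
    for k
    by (rule approx_envy_free_cuts[of N F "Suc k", OF F01]) (simp, simp, simp, blast)
  then obtain base y \<pi> where close: "\<And>k i j. i \<le> N \<Longrightarrow> \<bar>y k i j - base k j\<bar> \<le> 1 / real (Suc k)"
    and base: "\<And>k j. base k j \<in> {0..1}"
    and y1: "\<And>k i j. i \<le> N \<Longrightarrow> N \<le> j \<Longrightarrow> y k i j = (1::real)"
    and bij: "\<And>k. bij_betw (\<pi> k) {..N} {..N}"
    and ef: "\<And>k i j. i \<le> N \<Longrightarrow> j \<le> N \<Longrightarrow> F i (cut (y k i) (Suc j)) - F i (cut (y k i) j)
        \<le> F i (cut (y k i) (Suc (\<pi> k i))) - F i (cut (y k i) (\<pi> k i))"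
    by metis
  \<comment> \<open>Only finitely many assignments of pieces exist, so infinitely many meshes share
    one, which can be kept in the limit.\<close>
  have "finite ((\<lambda>k. restrict (\<pi> k) {..N}) ` UNIV)"
  proof (rule finite_subset)
    show "(\<lambda>k. restrict (\<pi> k) {..N}) ` UNIV \<subseteq> {..N} \<rightarrow>\<^sub>E {..N}"
      using bij by (fastforce simp: bij_betw_def restrict_PiE_iff)
  qed (simp add: finite_PiE)
  then obtain k0 where k0: "infinite {k. restrict (\<pi> k) {..N} = restrict (\<pi> k0) {..N}}"
    using pigeonhole_infinite[of UNIV "\<lambda>k. restrict (\<pi> k) {..N}"] by auto
  define s where "s = enumerate {k. restrict (\<pi> k) {..N} = restrict (\<pi> k0) {..N}}"
  have s: "strict_mono s"
    using k0 by (simp add: s_def strict_mono_enumerate)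
  have \<pi>s: "\<pi> (s k) i = \<pi> k0 i" if "i \<le> N" for k i
    using enumerate_in_set[OF k0, of k] that unfolding s_def
    by (auto dest!: fun_cong[of _ _ i])
  obtain r where r: "strict_mono r" "\<And>j. j < Suc N \<Longrightarrow> convergent (\<lambda>k. base (s (r k)) j)"
    using convergent_subsequence_coordinates[of "\<lambda>k. base (s k)" "Suc N"] base by blast
  \<comment> \<open>All players' vertices have the limit of \<open>base\<close>, as their distance
    to it tends to \<open>0\<close>; coordinates beyond \<open>N\<close> are constantly
    \<open>1\<close>.\<close>
  define z where "z j = (if j \<le> N then lim (\<lambda>k. base (s (r k)) j) else 1)" for j
  have sr: "strict_mono (\<lambda>k. s (r k))"
    using strict_mono_o[OF s r(1)] by (simp add: o_def)
  have small: "(\<lambda>k. 1 / real (Suc (s (r k)))) \<longlonglongrightarrow> 0"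
    using LIMSEQ_subseq_LIMSEQ[OF LIMSEQ_Suc[OF lim_1_over_n] sr] by (simp add: o_def)
  have base_lim: "(\<lambda>k. base (s (r k)) j) \<longlonglongrightarrow> z j" if "j \<le> N" for j
    using r(2)[of j] that by (simp add: z_def convergent_LIMSEQ_iff)
  have lim: "(\<lambda>k. y (s (r k)) i j) \<longlonglongrightarrow> z j" if i: "i \<le> N" for i j
  proof (cases "j \<le> N")
    case True
    have "(\<lambda>k. y (s (r k)) i j - base (s (r k)) j) \<longlonglongrightarrow> 0"
      by (rule Lim_null_comparison[OF _ small]) (use close[OF i] in auto)
    from tendsto_add[OF this base_lim[OF True]] show ?thesis
      by simp
  next
    case False
    then show ?thesis
      using y1[OF i] by (simp add: z_def)
  qed
  show thesis
  proof (rule that)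
    show "z j \<in> {0..1}" for j
    proof (cases "j \<le> N")
      case True
      show ?thesis
        using base by (intro closed_sequentially[OF closed_atLeastAtMost _ base_lim[OF True]]) blast
    qed (simp add: z_def)
    show "z N = 1"
      using LIMSEQ_unique[OF lim[of 0 N]] y1[of 0 N] by simp
    show "bij_betw (\<pi> k0) {..N} {..N}"
      by (fact bij)
    fix i j
    assume i: "i \<le> N" and j: "j \<le> N"
    have F: "(\<lambda>k. F i (cut (y (s (r k)) i) j)) \<longlonglongrightarrow> F i (cut z j)" for j
    proof (rule isCont_tendsto_compose[where g = "F i"])
      show "isCont (F i) (cut z j)"
        using cont[OF i] by (simp add: continuous_on_eq_continuous_at)
    qed (rule tendsto_cut[OF lim[OF i]])
    show "F i (cut z (Suc j)) - F i (cut z j) \<le> F i (cut z (Suc (\<pi> k0 i))) - F i (cut z (\<pi> k0 i))"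
    proof (rule LIMSEQ_le)
      show "(\<lambda>k. F i (cut (y (s (r k)) i) (Suc j)) - F i (cut (y (s (r k)) i) j))
          \<longlonglongrightarrow> F i (cut z (Suc j)) - F i (cut z j)"
        by (intro tendsto_diff F)
      show "(\<lambda>k. F i (cut (y (s (r k)) i) (Suc (\<pi> k0 i))) - F i (cut (y (s (r k)) i) (\<pi> k0 i)))
          \<longlonglongrightarrow> F i (cut z (Suc (\<pi> k0 i))) - F i (cut z (\<pi> k0 i))"
        by (intro tendsto_diff F)
      show "\<exists>K. \<forall>k\<ge>K. F i (cut (y (s (r k)) i) (Suc j)) - F i (cut (y (s (r k)) i) j)
          \<le> F i (cut (y (s (r k)) i) (Suc (\<pi> k0 i))) - F i (cut (y (s (r k)) i) (\<pi> k0 i))"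
        using ef[OF i j] \<pi>s[OF i] by metis
    qed
  qed
qed

section \<open>From cuts to a complete division\<close>

lemma complete_div_cut:
  assumes y: "\<And>j. y j \<in> {0..1}" "y N = 1" and bij: "bij_betw \<pi> {..N} {..N}"
  shows "complete_div (Suc N) (\<lambda>i. (cut y (\<pi> i), cut y (Suc (\<pi> i))))" (is "complete_div _ ?x")
proof -
  have step: "cut y j \<le> cut y (Suc j)" and bounds: "0 \<le> cut y j" "cut y j \<le> 1" for j
    using cut_bounds[of y j, OF y(1)] by auto
  have mono: "cut y i \<le> cut y j" if "i \<le> j" for i j
    using that step by (rule lift_Suc_mono_le[rotated])
  have disj: "{cut y i<..<cut y (Suc i)} \<inter> {cut y j<..<cut y (Suc j)} = {}" if "i < j" for i j
    using mono[of "Suc i" j] that by auto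
  have "piece ?x i \<inter> piece ?x j = {}" if "i < Suc N" "j < Suc N" "i \<noteq> j" for i j
  proof -
    have "\<pi> i \<noteq> \<pi> j"
      using bij that by (auto simp: bij_betw_def inj_on_def)
    then show ?thesis
      using disj[of "\<pi> i" "\<pi> j"] disj[of "\<pi> j" "\<pi> i"] by (auto simp: piece_def linorder_neq_iff)
  qed
  then have div: "division (Suc N) ?x"
    using bounds step by (auto simp: division_def simp del: cut.simps(2))
  have "(\<Union>i<Suc N. closure (piece ?x i)) = {0..1}"
  proof
    have "piece ?x i \<subseteq> {0..1}" for i
      using bounds[of "\<pi> i"] bounds[of "Suc (\<pi> i)"] by (auto simp: piece_def simp del: cut.simps(2))
    then have "closure (piece ?x i) \<subseteq> {0..1}" for i
      by (intro closure_minimal) auto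
    then show "(\<Union>i<Suc N. closure (piece ?x i)) \<subseteq> {0..1}"
      by blast
    show "{0..1} \<subseteq> (\<Union>i<Suc N. closure (piece ?x i))"
    proof
      fix t :: real
      assume t: "t \<in> {0..1}"
      have end1: "cut y (Suc N) = 1"
        using y(2) by simp
      \<comment> \<open>The closure of an empty piece is empty, so \<open>t\<close> must be placed
        in a piece of positive length. The first cut above \<open>0\<close>, or for
        \<open>t > 0\<close> the first cut at or above \<open>t\<close>, is the right end of such a
        piece.\<close>
      have "\<exists>j\<le>N. cut y j \<le> t \<and> t \<le> cut y (Suc j) \<and> cut y j < cut y (Suc j)"
      proof (cases "t = 0")
        case True
        define k where "k = (LEAST j. cut y j > 0)"
        have k: "cut y k > 0" "k \<le> Suc N"
          using LeastI[of "\<lambda>j. cut y j > 0" "Suc N"] Least_le[of "\<lambda>j. cut y j > 0" "Suc N"] end1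
          by (auto simp: k_def simp del: cut.simps(2))
        then obtain j where j: "k = Suc j"
          by (cases k) auto
        then have "\<not> cut y j > 0"
          using not_less_Least[of j "\<lambda>j. cut y j > 0"] by (simp add: k_def)
        then show ?thesis
          using k j True bounds[of j] by (intro exI[of _ j]) auto
      next
        case False
        define k where "k = (LEAST j. cut y j \<ge> t)"
        have k: "cut y k \<ge> t" "k \<le> Suc N"
          using LeastI[of "\<lambda>j. cut y j \<ge> t" "Suc N"] Least_le[of "\<lambda>j. cut y j \<ge> t" "Suc N"] end1 t
          by (auto simp: k_def simp del: cut.simps(2))
        then obtain j where j: "k = Suc j"
          using False t by (cases k) auto
        then have "\<not> cut y j \<ge> t"
          using not_less_Least[of j "\<lambda>j. cut y j \<ge> t"] by (simp add: k_def)
        then show ?thesis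
          using k j by (intro exI[of _ j]) auto
      qed
      then obtain j where j: "j \<le> N" "t \<in> {cut y j..cut y (Suc j)}" "cut y j < cut y (Suc j)"
        by auto
      obtain i where i: "i \<le> N" "\<pi> i = j"
        using bij j(1) by (auto simp: bij_betw_def image_iff dest!: equalityD2)
      then have "t \<in> closure (piece ?x i)"
        using j by (simp add: piece_def closure_greaterThanLessThan del: cut.simps(2))
      then show "t \<in> (\<Union>i<Suc N. closure (piece ?x i))"
        using i by (auto simp: less_Suc_eq_le)
    qed
  qed
  with div show ?thesis
    by (simp add: complete_div_def)
qed

theorem envy_free_complete_division_exists:
  assumes "n \<ge> 1" "cake_instance n v"
  obtains x where "complete_div n x" "envy_free n v x"
proof -
  obtain N where N: "n = Suc N"
    using assms(1) by (cases n) auto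
  have val: "valuation (v i)" if "i \<le> N" for i
    using assms that by (simp add: cake_instance_def N)
  obtain y \<pi> where y: "\<And>j. y j \<in> {0..1}" "y N = 1" and bij: "bij_betw \<pi> {..N} {..N}"
    and ef: "\<And>i j. i \<le> N \<Longrightarrow> j \<le> N \<Longrightarrow> vcdf (v i) (cut y (Suc j)) - vcdf (v i) (cut y j)
        \<le> vcdf (v i) (cut y (Suc (\<pi> i))) - vcdf (v i) (cut y (\<pi> i))"
  proof (rule envy_free_cuts[of N "\<lambda>i. vcdf (v i)"])
    show "vcdf (v i) 0 < vcdf (v i) 1" if "i \<le> N" for i
      using val[OF that] by (simp add: vcdf_0 vcdf_1)
  qed (use val in \<open>auto intro: continuous_vcdf\<close>)
  define x where "x i = (cut y (\<pi> i), cut y (Suc (\<pi> i)))" for i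
  have comp: "complete_div n x"
    using complete_div_cut[of y N \<pi>, OF y bij] by (simp add: x_def[abs_def] N)
  then have div: "division n x"
    by (simp add: complete_div_def)
  have "\<pi> i \<le> N" if "i \<le> N" for i
    using bij that by (auto simp: bij_betw_def)
  then have "envy_free n v x"
    unfolding envy_free_def using ef
    by (auto simp: util_vcdf[OF assms(2) div] N less_Suc_eq_le x_def simp del: cut.simps(2))
  with comp show thesis
    by (rule that)
qed

section \<open>The upper bound\<close>

definition clip :: "real \<Rightarrow> real \<Rightarrow> real \<Rightarrow> real" where
  "clip a b t = max a (min t b)"

lemma continuous_clip: "continuous_on UNIV (clip a b)"
  unfolding clip_def by (intro continuous_intros)

lemma mono_clip: "mono (clip a b)"
  by (auto simp: mono_def clip_def)

section \<open>Overlaps of two divisions\<close>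

lemma disjoint_intervals:
  fixes a b c d :: real
  assumes "{a<..<b} \<inter> {c<..<d} = {}"
  shows "b \<le> a \<or> d \<le> c \<or> b \<le> c \<or> d \<le> a"
proof (rule ccontr)
  assume "\<not> ?thesis"
  then obtain t where "max a c < t" "t < min b d"
    using dense[of "max a c" "min b d"] by auto
  then have "t \<in> {a<..<b} \<inter> {c<..<d}"
    by auto
  with assms show False
    by blast
qed

text \<open>An overlapping pair is determined by the one of its two pieces that starts later.\<close>

lemma card_overlaps_le:
  fixes x y :: "nat \<Rightarrow> real \<times> real"
  assumes x: "division n x" and y: "division n y"
  shows "card {(i, j). i < n \<and> j < n \<and> piece y i \<inter> piece x j \<noteq> {}} \<le> 2 * n"
proof -
  define A where "A = {(i, j). i < n \<and> j < n \<and> piece y i \<inter> piece x j \<noteq> {}}"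
  define f where "f = (\<lambda>(i, j). if fst (y i) \<le> fst (x j) then Inr j else (Inl i :: nat + nat))"
  have iv: "fst (y i) < snd (x j) \<and> fst (x j) < snd (y i) \<and> fst (y i) < snd (y i) \<and> fst (x j) < snd (x j)"
    if "(i, j) \<in> A" for i j
    using that by (auto simp: A_def piece_def)
  have eq: "i = i'"
    if z: "division n z" and "i < n" "i' < n" "t \<in> {fst (z i)..<snd (z i)}" "t \<in> {fst (z i')..<snd (z i')}"
    for z :: "nat \<Rightarrow> real \<times> real" and i i' t
  proof (rule ccontr)
    assume "i \<noteq> i'"
    then have "piece z i \<inter> piece z i' = {}"
      using that by (auto simp: division_def)
    then show False
      using that disjoint_intervals[of "fst (z i)" "snd (z i)" "fst (z i')" "snd (z i')"]
      by (simp add: piece_def)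
  qed
  have inj: "inj_on f A"
  proof (rule inj_onI, clarify)
    fix i j i' j'
    assume A: "(i, j) \<in> A" "(i', j') \<in> A" and f: "f (i, j) = f (i', j')"
    show "i = i' \<and> j = j'"
    proof (cases "fst (y i) \<le> fst (x j)")
      case True
      then have "j = j'" "fst (y i') \<le> fst (x j')"
        using f by (auto simp: f_def split: if_splits)
      moreover have "i = i'"
        using A True calculation iv[OF A(1)] iv[OF A(2)]
        by (intro eq[OF y, of i i' "fst (x j)"]) (auto simp: A_def)
      ultimately show ?thesis
        by blast
    next
      case False
      then have "i = i'" "fst (x j') < fst (y i')"
        using f by (auto simp: f_def split: if_splits)
      moreover have "j = j'"
        using A False calculation iv[OF A(1)] iv[OF A(2)]
        by (intro eq[OF x, of j j' "fst (y i)"]) (auto simp: A_def)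
      ultimately show ?thesis
        by blast
    qed
  qed
  have "f (i, j) \<in> Inl ` {..<n} \<union> Inr ` {..<n}" if "(i, j) \<in> A" for i j
    using that by (simp add: A_def f_def)
  then have "f ` A \<subseteq> Inl ` {..<n} \<union> Inr ` {..<n}"
    by fast
  with inj have "card A \<le> card (Inl ` {..<n} \<union> Inr ` {..<n} :: (nat + nat) set)"
    by (intro card_inj_on_le) auto
  also have "\<dots> \<le> n + n"
    by (intro order_trans[OF card_Un_le]) (simp add: card_image)
  finally show ?thesis
    unfolding A_def by linarith
qed

text \<open>A complete division hands out the whole value \<open>1\<close>, and an unenvious
  player's own piece is worth at least the average.\<close>

lemma envy_free_proportional:
  assumes "n \<ge> 1" "cake_instance n v" "complete_div n x" "envy_free n v x" "i < n"
  shows "1 / real n \<le> util v x i i"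
proof -
  have val: "valuation (v i)" and div: "division n x"
    using assms by (auto simp: cake_instance_def complete_div_def)
  have "1 = (\<Sum>j<n. util v x i j)"
    using complete_div_sum_eq[OF continuous_vcdf[OF val] mono_vcdf[OF val] assms(3)]
    by (simp add: util_vcdf[OF assms(2) div assms(5)] vcdf_0[OF val] vcdf_1[OF val])
  also have "\<dots> \<le> (\<Sum>j<n. util v x i i)"
    using assms(4,5) by (intro sum_mono) (auto simp: envy_free_def)
  finally show ?thesis
    using assms(1) by (simp add: field_simps)
qed

text \<open>The pieces of \<open>x\<close> cut piece \<open>i\<close> of \<open>y\<close> into
  parts; each part is worth no more than the piece of \<open>x\<close> containing it, which player
  \<open>i\<close> does not envy.\<close>

lemma util_le_overlaps:
  assumes "cake_instance n v" "complete_div n x" "envy_free n v x" "division n y" "i < n"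
  shows "util v y i i \<le> real (card {j. j < n \<and> piece y i \<inter> piece x j \<noteq> {}}) * util v x i i"
proof -
  have val: "valuation (v i)" and div: "division n x"
    using assms by (auto simp: cake_instance_def complete_div_def)
  let ?F = "vcdf (v i)"
  \<comment> \<open>Composing with \<open>clip\<close> restricts the valuation to piece
    \<open>i\<close> of \<open>y\<close>, so that the mass identity for \<open>x\<close> adds up the
    parts.\<close>
  let ?G = "\<lambda>t. ?F (clip (fst (y i)) (snd (y i)) t)"
  have mono: "?F s \<le> ?F t" if "s \<le> t" for s t
    using monoD[OF mono_vcdf[OF val] that] .
  have yi: "0 \<le> fst (y i)" "fst (y i) \<le> snd (y i)" "snd (y i) \<le> 1"
    using assms by (auto simp: division_def)
  have "continuous_on UNIV ?G"
    using continuous_on_compose2[OF continuous_vcdf[OF val] continuous_clip] by auto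
  moreover have "mono ?G"
    using mono_clip by (auto simp: mono_def intro!: mono)
  ultimately have "(\<Sum>j<n. ?G (snd (x j)) - ?G (fst (x j))) = ?G 1 - ?G 0"
    using assms(2) by (rule complete_div_sum_eq)
  also have "\<dots> = util v y i i"
    using yi assms by (simp add: util_vcdf clip_def)
  finally have "util v y i i = (\<Sum>j<n. ?G (snd (x j)) - ?G (fst (x j)))" ..
  also have "\<dots> \<le> (\<Sum>j<n. if piece y i \<inter> piece x j \<noteq> {} then util v x i i else 0)"
  proof (rule sum_mono)
    fix j
    assume j: "j \<in> {..<n}"
    then have xj: "fst (x j) \<le> snd (x j)"
      using div by (simp add: division_def)
    show "?G (snd (x j)) - ?G (fst (x j)) \<le> (if piece y i \<inter> piece x j \<noteq> {} then util v x i i else 0)"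
    proof (cases "piece y i \<inter> piece x j = {}")
      case True
      then have "clip (fst (y i)) (snd (y i)) (snd (x j)) = clip (fst (y i)) (snd (y i)) (fst (x j))"
        using xj yi disjoint_intervals[of "fst (y i)" "snd (y i)" "fst (x j)" "snd (x j)"]
        by (auto simp: piece_def clip_def)
      with True show ?thesis
        by simp
    next
      case False
      then have "?G (snd (x j)) \<le> ?F (snd (x j))" "?F (fst (x j)) \<le> ?G (fst (x j))"
        by (auto simp: piece_def clip_def intro!: mono)
      then have "?G (snd (x j)) - ?G (fst (x j)) \<le> util v x i j"
        using j by (simp add: util_vcdf[OF assms(1) div assms(5)])
      also have "\<dots> \<le> util v x i i"
        using assms j by (simp add: envy_free_def)
      finally show ?thesis
        using False by simp
    qed
  qed
  also have "\<dots> = real (card {j. j < n \<and> piece y i \<inter> piece x j \<noteq> {}}) * util v x i i"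
    by (subst sum.inter_filter[symmetric]) simp_all
  finally show ?thesis .
qed

lemma utilitarian_le_sqrt:
  assumes n: "n \<ge> 1" and v: "cake_instance n v" and x: "complete_div n x" "envy_free n v x"
    and y: "division n y"
  shows "utilitarian n v y \<le> sqrt (2 * real n) * utilitarian n v x"
proof -
  define k where "k i = card {j. j < n \<and> piece y i \<inter> piece x j \<noteq> {}}" for i
  have div: "division n x"
    using x by (simp add: complete_div_def)
  have pos: "1 / real n \<le> util v x i i" if "i < n" for i
    using envy_free_proportional[OF n v x that] .
  have "(\<Sum>i<n. 1 / real n) \<le> utilitarian n v x"
    unfolding utilitarian_def using pos by (intro sum_mono) auto
  then have S: "1 \<le> utilitarian n v x"
    using n by simp
  \<comment> \<open>A value in \<open>[0, 1]\<close> is at least its square; with the overlap bound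
    this gives a product of roots suited to Cauchy--Schwarz.\<close>
  have "util v y i i \<le> sqrt (real (k i)) * sqrt (util v x i i)" if i: "i < n" for i
  proof -
    have "util v y i i \<le> 1"
      using i v prob_space.prob_le_1 by (auto simp: util_def cake_instance_def valuation_def)
    moreover have "0 \<le> util v y i i"
      by (simp add: util_def)
    ultimately have "(util v y i i)\<^sup>2 \<le> util v y i i"
      by (simp add: power2_eq_square mult_left_le)
    also have "\<dots> \<le> real (k i) * util v x i i"
      unfolding k_def by (rule util_le_overlaps[OF v x y i])
    finally show ?thesis
      by (metis real_le_rsqrt real_sqrt_mult)
  qed
  then have "utilitarian n v y \<le> (\<Sum>i<n. sqrt (real (k i)) * sqrt (util v x i i))"
    unfolding utilitarian_def by (intro sum_mono) auto
  also have "\<dots> \<le> sqrt ((\<Sum>i<n. (sqrt (real (k i)))\<^sup>2) * (\<Sum>i<n. (sqrt (util v x i i))\<^sup>2))"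
    by (intro real_le_rsqrt Cauchy_Schwarz_ineq_sum)
  also have "\<dots> = sqrt (real (\<Sum>i<n. k i) * utilitarian n v x)"
    by (simp add: utilitarian_def util_def)
  also have "(\<Sum>i<n. k i) = card (SIGMA i:{..<n}. {j. j < n \<and> piece y i \<inter> piece x j \<noteq> {}})"
    by (simp add: k_def)
  also have "\<dots> = card {(i, j). i < n \<and> j < n \<and> piece y i \<inter> piece x j \<noteq> {}}"
    by (intro arg_cong[where f = card]) auto
  \<comment> \<open>The welfare of \<open>x\<close> is at least \<open>1\<close>, so under the root
    it may be replaced by its square.\<close>
  also have "sqrt (real \<dots> * utilitarian n v x) \<le> sqrt (real (2 * n) * (utilitarian n v x)\<^sup>2)"
    using S card_overlaps_le[OF div y]
    by (intro real_sqrt_le_mono mult_mono) (auto simp: power2_eq_square simp del: of_nat_mult)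
  also have "\<dots> = sqrt (2 * real n) * utilitarian n v x"
    using S by (simp add: real_sqrt_mult)
  finally show ?thesis .
qed

theorem utilitarian_dumping_le:
  assumes n: "n \<ge> 1" and v: "cake_instance n v" and \<alpha>: "utilitarian_dumping n v \<alpha>"
  shows "\<alpha> \<le> sqrt 2 * sqrt (real n)"
proof -
  obtain x where x: "complete_div n x" "envy_free n v x"
    using envy_free_complete_division_exists[OF n v] .
  obtain y where y: "division n y" "\<alpha> * utilitarian n v x \<le> utilitarian n v y"
    using \<alpha> x by (auto simp: utilitarian_dumping_def partial_div_def)
  have "(\<Sum>i<n. 1 / real n) \<le> utilitarian n v x"
    unfolding utilitarian_def using envy_free_proportional[OF n v x] by (intro sum_mono) auto
  then have "0 < utilitarian n v x"
    using n by simp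
  moreover have "\<alpha> * utilitarian n v x \<le> sqrt (2 * real n) * utilitarian n v x"
    using y utilitarian_le_sqrt[OF n v x y(1)] by linarith
  ultimately show ?thesis
    by (simp add: real_sqrt_mult)
qed

section \<open>The densities of the lower-bound instance\<close>

text \<open>For \<open>a \<le> b\<close> this is the distribution function of density
  \<open>1\<close> on \<open>[a, b]\<close>.\<close>

definition ramp :: "real \<Rightarrow> real \<Rightarrow> real \<Rightarrow> real" where
  "ramp a b t = clip a b t - a"

text \<open>
  Clusters start at even and end at odd integers, so that \<open>[2j, 2j + 1]\<close> contains two of them and
  \<open>[2j + 1, 2j + 2]\<close> none.
\<close>

definition cluster_pos :: "nat \<Rightarrow> nat \<Rightarrow> real" where
  "cluster_pos k c = real (40 * k + c) - (if odd c then 1 / 200 else 0)"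

text \<open>Each cluster has mass \<open>1\<close>, spread over width \<open>1 / 200\<close>; the
  factor 30 comes in with \<open>player_cdf\<close>.\<close>

definition clusters :: "nat \<Rightarrow> real \<Rightarrow> real" where
  "clusters k t = (\<Sum>c<40. 200 * ramp (cluster_pos k c) (cluster_pos k c + 1 / 200) t)"

lemma continuous_ramp: "continuous_on UNIV (ramp a b)"
  unfolding ramp_def using continuous_clip by (intro continuous_intros)

lemma continuous_clusters: "continuous_on UNIV (clusters k)"
  unfolding clusters_def by (intro continuous_intros continuous_ramp)

lemma ramp_mono: "s \<le> t \<Longrightarrow> ramp a b s \<le> ramp a b t"
  by (auto simp: ramp_def clip_def)

lemma ramp_diff_le: "a \<le> b \<Longrightarrow> ramp a b t - ramp a b s \<le> b - a"
  by (auto simp: ramp_def clip_def max_def min_def)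

lemma clusters_mono: "s \<le> t \<Longrightarrow> clusters k s \<le> clusters k t"
  unfolding clusters_def by (intro sum_mono mult_left_mono ramp_mono) auto

lemma ramp_clip: "A \<le> a \<Longrightarrow> a \<le> b \<Longrightarrow> b \<le> B \<Longrightarrow> ramp a b (clip A B t) = ramp a b t"
  by (auto simp: ramp_def clip_def)

lemma cluster_pos_bounds:
  assumes "c < 40"
  shows "real (40 * k) \<le> cluster_pos k c" "cluster_pos k c + 1 / 200 \<le> real (40 * k) + 40"
proof -
  have "real c \<ge> 1" if "odd c"
    using that by (cases c) auto
  moreover have "real c \<le> 38" if "even c"
    using that assms by (cases "c = 39") auto
  ultimately show "real (40 * k) \<le> cluster_pos k c" "cluster_pos k c + 1 / 200 \<le> real (40 * k) + 40"
    using assms by (auto simp: cluster_pos_def)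
qed

text \<open>All clusters of group \<open>k\<close> lie inside the group, so a piece may be replaced
  by its trace on the group.\<close>

lemma clusters_clip: "clusters k (clip (real (40 * k)) (real (40 * k) + 40) t) = clusters k t"
  unfolding clusters_def using cluster_pos_bounds by (intro sum.cong refl) (simp add: ramp_clip)

lemma clusters_left: "t \<le> real (40 * k) \<Longrightarrow> clusters k t = 0"
  unfolding clusters_def using cluster_pos_bounds(1)[of _ k]
  by (intro sum.neutral) (force simp: ramp_def clip_def)

lemma clusters_right:
  assumes "real (40 * k) + 40 \<le> t"
  shows "clusters k t = 40"
proof -
  have "clusters k t = (\<Sum>c<40::nat. 1)"
    unfolding clusters_def using cluster_pos_bounds(2)[of _ k] assms
    by (intro sum.cong) (force simp: ramp_def clip_def)+
  then show ?thesis
    by simp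
qed

lemma clusters_diff_le_card:
  assumes "s \<le> t" "\<And>c. c < 40 \<Longrightarrow> c \<notin> T \<Longrightarrow> t \<le> cluster_pos k c \<or> cluster_pos k c + 1 / 200 \<le> s" "finite T"
  shows "clusters k t - clusters k s \<le> real (card T)"
proof -
  have "clusters k t - clusters k s =
      (\<Sum>c<40. 200 * (ramp (cluster_pos k c) (cluster_pos k c + 1 / 200) t - ramp (cluster_pos k c) (cluster_pos k c + 1 / 200) s))"
    by (simp add: clusters_def sum_subtractf right_diff_distrib)
  also have "\<dots> \<le> (\<Sum>c<40. if c \<in> T then 1 else 0)"
  proof (rule sum_mono)
    fix c :: nat
    assume "c \<in> {..<40}"
    then have "c \<in> T \<or> t \<le> cluster_pos k c \<or> cluster_pos k c + 1 / 200 \<le> s"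
      using assms(2) by blast
    then show "200 * (ramp (cluster_pos k c) (cluster_pos k c + 1 / 200) t - ramp (cluster_pos k c) (cluster_pos k c + 1 / 200) s)
        \<le> (if c \<in> T then 1 else 0)"
    proof (elim disjE)
      assume "c \<in> T"
      then show ?thesis
        using ramp_diff_le[of "cluster_pos k c" "cluster_pos k c + 1 / 200" t s] by simp
    qed (use assms(1) in \<open>auto simp: ramp_def clip_def\<close>)
  qed
  also have "\<dots> = real (card ({..<40} \<inter> T))"
    by (simp add: sum.If_cases)
  also have "\<dots> \<le> real (card T)"
    using assms(3) by (simp add: card_mono)
  finally show ?thesis .
qed

lemma card_le_clusters_diff:
  assumes "s \<le> t" "T \<subseteq> {..<40}" "\<And>c. c \<in> T \<Longrightarrow> s \<le> cluster_pos k c \<and> cluster_pos k c + 1 / 200 \<le> t"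
  shows "real (card T) \<le> clusters k t - clusters k s"
proof -
  have "real (card T) = (\<Sum>c<40. if c \<in> T then 1 else 0)"
    using assms(2) by (simp add: sum.If_cases Int_absorb1)
  also have "\<dots> \<le> (\<Sum>c<40. 200 * (ramp (cluster_pos k c) (cluster_pos k c + 1 / 200) t - ramp (cluster_pos k c) (cluster_pos k c + 1 / 200) s))"
  proof (intro sum_mono)
    fix c
    show "(if c \<in> T then 1 else 0) \<le> 200 * (ramp (cluster_pos k c) (cluster_pos k c + 1 / 200) t - ramp (cluster_pos k c) (cluster_pos k c + 1 / 200) s)"
      using assms(3)[of c] ramp_mono[OF assms(1), of "cluster_pos k c" "cluster_pos k c + 1 / 200"]
      by (auto simp: ramp_def clip_def)
  qed
  also have "\<dots> = clusters k t - clusters k s"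
    by (simp add: clusters_def sum_subtractf right_diff_distrib)
  finally show ?thesis .
qed

text \<open>The cluster at the first integer after \<open>s\<close> serves, unless it is an odd one
  starting before \<open>s\<close>. Then that integer is below \<open>s + 1 / 200\<close>, and the
  next cluster, an even one, ends before \<open>s + 1 + 2 / 200\<close>.\<close>

lemma clusters_long:
  assumes "real (40 * k) \<le> s" "t \<le> real (40 * k) + 40" "s + 101 / 100 \<le> t"
  shows "1 \<le> clusters k t - clusters k s"
proof -
  define z where "z = nat \<lceil>s - real (40 * k)\<rceil>"
  have z: "s \<le> real (40 * k) + real z" "real (40 * k) + real z < s + 1"
    using assms(1) unfolding z_def by linarith+
  have "real z < 40"
    using z assms(2,3) by linarith
  then have z40: "z < 40"
    by simp
  have "\<exists>c<40. s \<le> cluster_pos k c \<and> cluster_pos k c + 1 / 200 \<le> t"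
  proof (cases "odd z \<and> real (40 * k) + real z - 1 / 200 < s")
    case False
    then show ?thesis
      using z z40 assms by (intro exI[of _ z]) (auto simp: cluster_pos_def)
  next
    case True
    have "z \<noteq> 39"
      using True assms by auto
    then show ?thesis
      using z z40 assms True by (intro exI[of _ "Suc z"]) (auto simp: cluster_pos_def)
  qed
  then obtain c where "c < 40" "s \<le> cluster_pos k c \<and> cluster_pos k c + 1 / 200 \<le> t"
    by blast
  then show ?thesis
    using card_le_clusters_diff[of s t "{c}" k] assms by simp
qed

text \<open>Neighbouring clusters start at least \<open>199 / 200\<close> apart, which leaves a gap
  of at least \<open>99 / 100\<close> between them.\<close>

lemma clusters_short:
  assumes "s \<le> t" "t \<le> s + 99 / 100"
  shows "clusters k t - clusters k s \<le> 1"
proof -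
  define T where "T = {c. c < 40 \<and> \<not> (t \<le> cluster_pos k c \<or> cluster_pos k c + 1 / 200 \<le> s)}"
  have "c = c'" if "c \<in> T" "c' \<in> T" for c c'
  proof (rule ccontr)
    assume "c \<noteq> c'"
    then have "\<bar>real c - real c'\<bar> \<ge> 1"
      by linarith
    moreover have "even c' = odd c" if "\<bar>real c - real c'\<bar> < 2"
    proof -
      have "c' = Suc c \<or> c = Suc c'"
        using that \<open>c \<noteq> c'\<close> by linarith
      then show ?thesis
        by auto
    qed
    ultimately have "\<bar>cluster_pos k c - cluster_pos k c'\<bar> \<ge> 199 / 200"
      by (auto simp: cluster_pos_def abs_if split: if_splits)
    with that assms show False
      by (auto simp: T_def abs_if split: if_splits)
  qed
  then have "card T \<le> 1"
    by (simp add: T_def card_le_Suc0_iff_eq)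
  with clusters_diff_le_card[OF assms(1), of T k] show ?thesis
    by (auto simp: T_def)
qed

text \<open>
  With \<open>M = m * m\<close>: the first \<open>20 * M\<close> players are the common ones, the next \<open>20 * M\<close> the group players
  (20 consecutive ones per group), the last \<open>m\<close> the rich ones. Groups occupy \<open>[0, 40 * M]\<close>, the dump
  \<open>[40 * M, 41 * M]\<close> and the cells \<open>[41 * M, 42 * M]\<close>. The values are not normalised.
\<close>

definition player_cdf :: "nat \<Rightarrow> nat \<Rightarrow> real \<Rightarrow> real" where
  "player_cdf m i t =
     (if i < 20 * (m * m) then ramp 0 (41 * real (m * m)) t
      else if i < 40 * (m * m) then
        (let k = (i - 20 * (m * m)) div 20 in
          ramp 0 (41 * real (m * m)) t + 9 * ramp (real (40 * k)) (real (40 * k) + 40) t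
          + 30 * clusters k t + 65 * ramp (41 * real (m * m) + real k) (41 * real (m * m) + real k + 1) t)
      else (let j = i - 40 * (m * m) in
          ramp (41 * real (m * m) + real (j * m)) (41 * real (m * m) + real (j * m) + real m) t))"

lemma continuous_player_cdf: "continuous_on UNIV (player_cdf m i)"
  unfolding player_cdf_def Let_def
  by (cases "i < 20 * (m * m)"; cases "i < 40 * (m * m)")
    (auto intro!: continuous_intros continuous_ramp continuous_clusters)

lemma mono_player_cdf: "mono (player_cdf m i)"
  unfolding player_cdf_def Let_def mono_def
  by (auto intro!: add_mono mult_left_mono ramp_mono clusters_mono)

section \<open>Envy-free complete divisions of the instance\<close>

lemma player_cdf_total:
  assumes "M = m * m"
  shows "i < 20 * M \<Longrightarrow> player_cdf m i (42 * real M) = 41 * real M"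
    and "20 * M \<le> i \<Longrightarrow> i < 40 * M \<Longrightarrow> player_cdf m i (42 * real M) = 41 * real M + 1625"
    and "40 * M \<le> i \<Longrightarrow> i < 40 * M + m \<Longrightarrow> player_cdf m i (42 * real M) = real m"
proof -
  show "player_cdf m i (42 * real M) = 41 * real M" if "i < 20 * M"
    using that by (simp add: player_cdf_def ramp_def clip_def flip: assms)
  \<comment> \<open>The extra mass is \<open>9 * 40 + 30 * 40 + 65 = 1625\<close>.\<close>
  show "player_cdf m i (42 * real M) = 41 * real M + 1625" if i: "20 * M \<le> i" "i < 40 * M"
  proof -
    define k where "k = (i - 20 * M) div 20"
    have "k < M"
      unfolding k_def using i by (intro div_less_iff_less_mult[THEN iffD2]) auto
    then have "real (40 * k) + 40 \<le> 42 * real M" "real k + 1 \<le> real M"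
      by linarith+
    then show ?thesis
      using i clusters_right[of k "42 * real M"]
      by (simp add: player_cdf_def Let_def ramp_def clip_def k_def[symmetric] flip: assms)
  qed
  show "player_cdf m i (42 * real M) = real m" if i: "40 * M \<le> i" "i < 40 * M + m"
  proof -
    have "Suc (i - 40 * M) * m \<le> m * m"
      using i by (intro mult_le_mono1) simp
    then have "(i - 40 * M) * m + m \<le> M"
      by (simp add: assms)
    then have "real ((i - 40 * M) * m) + real m \<le> real M"
      by (metis of_nat_add of_nat_mono)
    then show ?thesis
      using i by (simp add: player_cdf_def Let_def ramp_def clip_def flip: assms)
  qed
qed

lemma player_cdf_0: "player_cdf m i 0 = 0"
  using clusters_left[of 0] by (auto simp: player_cdf_def Let_def ramp_def clip_def)

text \<open>An envy-free complete division in units, player \<open>i\<close> owning the interval from \<open>l i\<close> to \<open>r i\<close>.\<close>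

locale unit_division =
  fixes m :: nat and M :: nat and l r :: "nat \<Rightarrow> real"
  assumes m2: "2 \<le> m" and M_def: "M = m * m"
    and ord: "\<And>i. i < 40 * M + m \<Longrightarrow> 0 \<le> l i \<and> l i \<le> r i \<and> r i \<le> 42 * real M"
    and disj: "\<And>i j. i < 40 * M + m \<Longrightarrow> j < 40 * M + m \<Longrightarrow> i \<noteq> j \<Longrightarrow>
      {l i<..<r i} \<inter> {l j<..<r j} = {}"
    and cover: "\<And>F :: real \<Rightarrow> real. continuous_on UNIV F \<Longrightarrow> mono F \<Longrightarrow>
      (\<Sum>i<40 * M + m. F (r i) - F (l i)) = F (42 * real M) - F 0"
    and ef: "\<And>i j. i < 40 * M + m \<Longrightarrow> j < 40 * M + m \<Longrightarrow>
      player_cdf m i (r j) - player_cdf m i (l j) \<le> player_cdf m i (r i) - player_cdf m i (l i)"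
begin

abbreviation n :: nat where "n \<equiv> 40 * M + m"

section \<open>Parts of the value of a piece\<close>

definition base_len :: "nat \<Rightarrow> real" where
  "base_len i = ramp 0 (41 * real M) (r i) - ramp 0 (41 * real M) (l i)"

definition group_len :: "nat \<Rightarrow> nat \<Rightarrow> real" where
  "group_len k i = ramp (real (40 * k)) (real (40 * k) + 40) (r i) - ramp (real (40 * k)) (real (40 * k) + 40) (l i)"

definition cluster_mass :: "nat \<Rightarrow> nat \<Rightarrow> real" where
  "cluster_mass k i = clusters k (r i) - clusters k (l i)"

definition cell_len :: "nat \<Rightarrow> nat \<Rightarrow> real" where
  "cell_len k i = ramp (41 * real M + real k) (41 * real M + real k + 1) (r i)
    - ramp (41 * real M + real k) (41 * real M + real k + 1) (l i)"

definition group_value :: "nat \<Rightarrow> nat \<Rightarrow> real" where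
  "group_value k i = base_len i + 9 * group_len k i + 30 * cluster_mass k i + 65 * cell_len k i"

definition group_of :: "nat \<Rightarrow> nat" where
  "group_of i = (i - 20 * M) div 20"

text \<open>Common players are identical, so by envy-freeness they all have the same
  \<open>base_len\<close>; player \<open>0\<close> represents them.\<close>

definition level :: real where "level = base_len 0"

lemma M4: "4 \<le> M" "2 * m \<le> M"
  using m2 mult_le_mono[OF m2 m2] by (auto simp: M_def)

lemma nonneg:
  assumes "i < n"
  shows "0 \<le> base_len i" "0 \<le> group_len k i" "0 \<le> cluster_mass k i" "0 \<le> cell_len k i"
  using ord[OF assms] by (auto simp: base_len_def group_len_def cluster_mass_def cell_len_def intro: ramp_mono clusters_mono)

lemma mono_segs: "mono (ramp a b)" and mono_clusters: "mono (clusters k)"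
  by (auto simp: mono_def intro: ramp_mono clusters_mono)

lemma sum_base_len: "(\<Sum>i<n. base_len i) = 41 * real M"
  using cover[OF continuous_ramp mono_segs, of 0 "41 * real M"] by (simp add: base_len_def ramp_def clip_def)

lemma sum_group_len: "k < M \<Longrightarrow> (\<Sum>i<n. group_len k i) = 40"
  using cover[OF continuous_ramp mono_segs, of "real (40 * k)" "real (40 * k) + 40"]
  by (simp add: group_len_def ramp_def clip_def)

lemma sum_cluster_mass: "k < M \<Longrightarrow> (\<Sum>i<n. cluster_mass k i) = 40"
  using cover[OF continuous_clusters mono_clusters, of k] clusters_left[of 0 k] clusters_right[of k "42 * real M"]
  by (simp add: cluster_mass_def)

lemma sum_cell_len: "k < M \<Longrightarrow> (\<Sum>i<n. cell_len k i) = 1"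
  using cover[OF continuous_ramp mono_segs, of "41 * real M + real k" "41 * real M + real k + 1"]
  by (simp add: cell_len_def ramp_def clip_def)

lemma player_U: "i < 20 * M \<Longrightarrow> player_cdf m i (r j) - player_cdf m i (l j) = base_len j"
  by (simp add: player_cdf_def base_len_def flip: M_def)

lemma player_P:
  "20 * M \<le> i \<Longrightarrow> i < 40 * M \<Longrightarrow> player_cdf m i (r j) - player_cdf m i (l j) = group_value (group_of i) j"
  by (simp add: player_cdf_def group_value_def group_of_def base_len_def group_len_def cluster_mass_def cell_len_def Let_def algebra_simps flip: M_def)

lemma ef_U: "i < 20 * M \<Longrightarrow> j < n \<Longrightarrow> base_len j \<le> base_len i"
  using ef[of i j] by (simp add: player_U)

lemma ef_P: "20 * M \<le> i \<Longrightarrow> i < 40 * M \<Longrightarrow> j < n \<Longrightarrow> group_value (group_of i) j \<le> group_value (group_of i) i"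
  using ef[of i j] by (simp add: player_P)

lemma base_len_U: "i < 20 * M \<Longrightarrow> base_len i = level"
  unfolding level_def using ef_U[of i 0] ef_U[of 0 i] M4 by (intro antisym) auto

lemma base_len_le: "i < n \<Longrightarrow> base_len i \<le> level"
  unfolding level_def using ef_U[of 0 i] M4 by auto

text \<open>At most \<open>81 / 2 * M\<close> pieces, none above \<open>level\<close>, absorb the
  length \<open>41 * M\<close> of groups and dump, so \<open>level \<ge> 82 / 81\<close>, which
  suffices for \<open>clusters_long\<close>. The upper bound counts the \<open>20 * M\<close> common
  pieces alone.\<close>

lemma level_bounds: "101 / 100 \<le> level" "level \<le> 41 / 20"
proof -
  have "41 * real M \<le> real n * level"
    using sum_bounded_above[of "{..<n}" base_len level] base_len_le by (simp add: sum_base_len)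
  also have "\<dots> \<le> (40 * real M + real M / 2) * level"
    using M4 nonneg(1)[of 0] by (intro mult_right_mono) (auto simp: level_def)
  finally have "real M * 41 \<le> real M * (81 / 2 * level)"
    by (simp add: algebra_simps)
  then have "41 \<le> 81 / 2 * level"
    using M4 by (subst (asm) mult_le_cancel_left_pos) auto
  then show "101 / 100 \<le> level"
    by simp
  have "real (20 * M) * level = (\<Sum>i<20 * M. base_len i)"
    using base_len_U by simp
  also have "\<dots> \<le> (\<Sum>i<n. base_len i)"
    by (intro sum_mono2) (auto simp: nonneg)
  finally have "real M * (20 * level) \<le> real M * 41"
    unfolding sum_base_len by (simp add: algebra_simps)
  then have "20 * level \<le> 41"
    using M4 by (subst (asm) mult_le_cancel_left_pos) auto
  then show "level \<le> 41 / 20"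
    by simp
qed

lemma group_len_le_base_len:
  assumes "k < M" "i < n"
  shows "group_len k i \<le> base_len i"
proof -
  have "real (40 * k) + 40 \<le> 41 * real M"
    using assms by linarith
  then show ?thesis
    using ord[OF assms(2)] by (auto simp: group_len_def base_len_def ramp_def clip_def)
qed

lemma outside_group:
  assumes "i < n" "group_len k i = 0"
  shows "cluster_mass k i = 0"
proof -
  have "clip (real (40 * k)) (real (40 * k) + 40) (r i) = clip (real (40 * k)) (real (40 * k) + 40) (l i)"
    using assms by (simp add: group_len_def ramp_def)
  then show ?thesis
    unfolding cluster_mass_def by (metis clusters_clip diff_self)
qed

text \<open>The dump separates groups from cells. A piece reaching both would contain it and have
  \<open>base_len\<close> above \<open>M\<close>, while \<open>level \<le> 41 / 20\<close>.\<close>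

lemma cell_len_outside_group:
  assumes "i < n" "k < M" "k' < M" "0 < cell_len k i"
  shows "group_len k' i = 0"
proof (rule ccontr)
  assume "group_len k' i \<noteq> 0"
  then have "l i < real (40 * k') + 40"
    using ord[OF assms(1)] by (auto simp: group_len_def ramp_def clip_def split: if_splits)
  moreover have "41 * real M < r i"
    using ord[OF assms(1)] assms(4) by (auto simp: cell_len_def ramp_def clip_def max_def min_def split: if_splits)
  moreover have "real (40 * k') + 40 \<le> 40 * real M"
    using assms by linarith
  ultimately have "real M < base_len i"
    using ord[OF assms(1)] by (auto simp: base_len_def ramp_def clip_def)
  then show False
    using base_len_le[OF assms(1)] level_bounds M4 by linarith
qed

section \<open>Pieces meeting a group and pieces inside it\<close>

definition meeting :: "nat \<Rightarrow> nat set" where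
  "meeting k = {i. i < n \<and> 0 < group_len k i}"

definition pieces_in :: "nat \<Rightarrow> nat set" where
  "pieces_in k = {i \<in> meeting k. real (40 * k) \<le> l i \<and> r i \<le> real (40 * k) + 40}"

lemma finite_pieces_in: "finite (pieces_in k)"
  by (auto simp: meeting_def pieces_in_def)

lemma card_across: "card {i. i < n \<and> l i < t \<and> t < r i} \<le> 1"
proof -
  have "i = j" if "i < n" "j < n" "l i < t" "t < r i" "l j < t" "t < r j" for i j
    using disj[of i j] that by (metis IntI empty_iff greaterThanLessThan_iff)
  then show ?thesis
    by (simp add: card_le_Suc0_iff_eq)
qed

text \<open>A piece that meets the group without lying in it crosses one of the two ends, and
  disjointness allows one piece per end.\<close>

lemma card_meeting_Int_le: "card (A \<inter> meeting k) \<le> card (A \<inter> pieces_in k) + 2"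
proof -
  let ?E = "\<lambda>t. {i. i < n \<and> l i < t \<and> t < r i}"
  have "A \<inter> meeting k \<subseteq> A \<inter> pieces_in k \<union> (?E (real (40 * k)) \<union> ?E (real (40 * k) + 40))"
  proof
    fix i
    assume i: "i \<in> A \<inter> meeting k"
    then have "l i < real (40 * k) + 40" "real (40 * k) < r i"
      using ord[of i] by (auto simp: meeting_def group_len_def ramp_def clip_def max_def min_def split: if_splits)
    with i show "i \<in> A \<inter> pieces_in k \<union> (?E (real (40 * k)) \<union> ?E (real (40 * k) + 40))"
      by (auto simp: pieces_in_def meeting_def)
  qed
  then have "card (A \<inter> meeting k) \<le> card (A \<inter> pieces_in k \<union> (?E (real (40 * k)) \<union> ?E (real (40 * k) + 40)))"
    by (intro card_mono) (auto simp: finite_pieces_in)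
  also have "\<dots> \<le> card (A \<inter> pieces_in k) + (card (?E (real (40 * k))) + card (?E (real (40 * k) + 40)))"
    by (intro order_trans[OF card_Un_le] add_left_mono card_Un_le)
  also have "\<dots> \<le> card (A \<inter> pieces_in k) + (1 + 1)"
    by (intro add_mono card_across order_refl)
  finally show ?thesis
    by simp
qed

lemma card_meeting_le: "card (meeting k) \<le> card (pieces_in k) + 2"
  using card_meeting_Int_le[of UNIV k] by simp

lemma meeting_bound:
  assumes "k < M" "\<And>i. i \<in> meeting k \<Longrightarrow> group_len k i \<le> c"
  shows "40 \<le> real (card (meeting k)) * c"
proof -
  have "40 = (\<Sum>i<n. group_len k i)"
    using assms by (simp add: sum_group_len)
  also have "\<dots> = (\<Sum>i\<in>meeting k. group_len k i)"
    using nonneg(2)[of _ k] by (intro sum.mono_neutral_right) (auto simp: meeting_def less_le)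
  also have "\<dots> \<le> real (card (meeting k)) * c"
    using assms(2) by (rule sum_bounded_above)
  finally show ?thesis .
qed

lemma pieces_in_base_len:
  assumes "k < M" "i \<in> pieces_in k"
  shows "group_len k i = base_len i" "cell_len k' i = 0" "k' \<noteq> k \<Longrightarrow> group_len k' i = 0" "i < 40 * M"
proof -
  have i: "i < n" "real (40 * k) \<le> l i" "r i \<le> real (40 * k) + 40" "l i \<le> r i"
    using assms ord[of i] by (auto simp: pieces_in_def meeting_def)
  have k: "real (40 * k) + 40 \<le> 40 * real M"
    using assms(1) by linarith
  show "group_len k i = base_len i" "cell_len k' i = 0"
    using i k by (auto simp: group_len_def base_len_def cell_len_def ramp_def clip_def)
  show "group_len k' i = 0" if "k' \<noteq> k"
  proof -
    have "real k' + 1 \<le> real k \<or> real k + 1 \<le> real k'"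
      using that by linarith
    then show ?thesis
      using i by (auto simp: group_len_def ramp_def clip_def)
  qed
  \<comment> \<open>A rich player with a piece inside a group would get nothing, hence by
    envy-freeness find every piece worthless, although the pieces add up to
    \<open>m\<close>.\<close>
  show "i < 40 * M"
  proof (rule ccontr)
    assume "\<not> i < 40 * M"
    then have iR: "40 * M \<le> i" "i - 40 * M < m"
      using i(1) by auto
    define a where "a = 41 * real M + real ((i - 40 * M) * m)"
    define F where "F = ramp a (a + real m)"
    have a: "41 * real M \<le> a"
      by (simp add: a_def)
    have F: "player_cdf m i = F"
      using iR by (auto simp: player_cdf_def Let_def fun_eq_iff F_def a_def simp flip: M_def)
    have "(i - 40 * M) * m + m \<le> M"
      using mult_le_mono1[of "Suc (i - 40 * M)" m m] iR(2) by (simp add: M_def)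
    then have "real ((i - 40 * M) * m) + real m \<le> real M"
      by (metis of_nat_add of_nat_mono)
    then have "(\<Sum>j<n. F (r j) - F (l j)) = real m"
      using cover[OF continuous_ramp mono_segs, of a "a + real m"] by (simp add: F_def a_def ramp_def clip_def)
    moreover have "F (r j) - F (l j) \<le> 0" if "j < n" for j
    proof -
      have "F (r j) - F (l j) \<le> F (r i) - F (l i)"
        using ef[OF i(1) that] by (simp add: F)
      also have "\<dots> = 0"
        using i k a by (simp add: F_def ramp_def clip_def)
      finally show ?thesis .
    qed
    then have "(\<Sum>j<n. F (r j) - F (l j)) \<le> 0"
      by (intro sum_nonpos) auto
    ultimately show False
      using m2 by simp
  qed
qed

text \<open>By envy-freeness the 20 players of group \<open>k\<close> value their own pieces
  equally; the first of them represents the group.\<close>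

definition best :: "nat \<Rightarrow> real" where
  "best k = group_value k (20 * M + 20 * k)"

lemma group_of_first: "group_of (20 * M + 20 * k) = k"
  by (simp add: group_of_def)

lemma group_of_less: "20 * M \<le> i \<Longrightarrow> i < 40 * M \<Longrightarrow> group_of i < M"
  unfolding group_of_def by (intro div_less_iff_less_mult[THEN iffD2]) auto

lemma group_value_le_best:
  assumes "k < M" "j < n"
  shows "group_value k j \<le> best k"
  using ef_P[of "20 * M + 20 * k" j] assms by (simp add: group_of_first best_def)

lemma group_value_own:
  assumes "20 * M \<le> i" "i < 40 * M"
  shows "group_value (group_of i) i = best (group_of i)"
  using group_value_le_best[of "group_of i" i] group_of_less[OF assms] assms ef_P[OF assms, of "20 * M + 20 * group_of i"]
  by (intro antisym) (auto simp: best_def)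

lemma own_eq:
  assumes "k < M"
  shows "{i. 20 * M \<le> i \<and> i < 40 * M \<and> group_of i = k} = {20 * M + 20 * k..<20 * M + 20 * k + 20}"
    (is "?A = ?B")
proof
  show "?A \<subseteq> ?B"
  proof
    fix i
    assume "i \<in> ?A"
    then have "20 * M \<le> i" "(i - 20 * M) div 20 = k"
      by (auto simp: group_of_def)
    then show "i \<in> ?B"
      using div_mult_mod_eq[of "i - 20 * M" 20] mod_less_divisor[of 20 "i - 20 * M"] by auto
  qed
  show "?B \<subseteq> ?A"
  proof
    fix i
    assume "i \<in> ?B"
    then obtain d where "i = 20 * M + 20 * k + d" "d < 20"
      by (metis atLeastLessThan_iff add_less_cancel_left le_iff_add)
    with assms show "i \<in> ?A"
      by (simp add: group_of_def add.assoc)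
  qed
qed

lemma pieces_in_value:
  assumes "k < M" "k' < M" "i \<in> pieces_in k" "k' \<noteq> k"
  shows "group_value k' i = base_len i"
proof -
  have "i < n"
    using assms by (auto simp: pieces_in_def meeting_def)
  then show ?thesis
    using pieces_in_base_len[OF assms(1,3)] assms(4) outside_group[of i k'] by (simp add: group_value_def)
qed

text \<open>
  If the players of group \<open>k\<close> got no more than \<open>level\<close>, their group would be cut so finely that at least
  190 pieces lie inside it. These belong to group players, all from groups with the same deficiency,
  and each such group has only 20 players.
\<close>

lemma best_gt_level:
  assumes "k < M"
  shows "level < best k"
proof -
  define S where "S = {k. k < M \<and> best k \<le> level}"
  have "S = {}"
  proof (rule ccontr)
    assume ne: "S \<noteq> {}"
    have fin: "finite S"
      by (simp add: S_def)
    have many: "190 \<le> card (pieces_in k)" if k: "k \<in> S" for k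
    proof -
      have kM: "k < M" "best k \<le> 41 / 20"
        using k level_bounds by (auto simp: S_def)
      \<comment> \<open>The density on the own group is at least 10, so pieces meet it in at most
        \<open>41 / 200\<close>, and \<open>40 / (41 / 200) > 195\<close>. Up to two of these pieces
        cross an end.\<close>
      have "group_len k i \<le> 41 / 200" if "i \<in> meeting k" for i
      proof -
        have i: "i < n"
          using that by (simp add: meeting_def)
        then have "10 * group_len k i \<le> group_value k i"
          using group_len_le_base_len[OF kM(1) i] nonneg(1)[OF i] nonneg(2-4)[OF i, of k] unfolding group_value_def by linarith
        also have "\<dots> \<le> 41 / 20"
          using group_value_le_best[OF kM(1) i] kM(2) by linarith
        finally show ?thesis
          by simp
      qed
      from meeting_bound[OF kM(1) this] have "195 < real (card (meeting k))"
        by simp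
      then show ?thesis
        using card_meeting_le[of k] by linarith
    qed
    have sub: "pieces_in k \<subseteq> {i. 20 * M \<le> i \<and> i < 40 * M \<and> group_of i \<in> S}" if k: "k \<in> S" for k
    proof
      fix i
      assume i: "i \<in> pieces_in k"
      have kM: "k < M" "best k \<le> level"
        using k by (auto simp: S_def)
      have iN: "i < n"
        using i by (auto simp: pieces_in_def meeting_def)
      \<comment> \<open>Ten times the length is worth at most \<open>level\<close>, so the piece is
        too short to be a common player's.\<close>
      have small: "10 * base_len i \<le> level"
        using group_value_le_best[OF kM(1) iN] kM(2) pieces_in_base_len(1)[OF kM(1) i] nonneg(1)[OF iN] nonneg(2-4)[OF iN, of k]
        unfolding group_value_def by linarith
      have "20 * M \<le> i"
      proof (rule ccontr)
        assume "\<not> 20 * M \<le> i"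
        then have "base_len i = level"
          by (intro base_len_U) simp
        with small level_bounds show False
          by simp
      qed
      moreover have i40: "i < 40 * M"
        using pieces_in_base_len(4)[OF kM(1) i] .
      moreover have "group_of i \<in> S"
      proof (cases "group_of i = k")
        case False
        \<comment> \<open>To a player of another group the piece is worth only its length, at most
          \<open>level\<close>, so that other group belongs to \<open>S\<close> too.\<close>
        have g: "group_of i < M"
          by (rule group_of_less) fact+
        have "best (group_of i) = group_value (group_of i) i"
          by (rule group_value_own[symmetric]) fact+
        also have "\<dots> = base_len i"
          by (rule pieces_in_value[OF kM(1) g i False])
        also have "\<dots> \<le> level"
          by (rule base_len_le[OF iN])
        finally show ?thesis
          using g by (simp add: S_def)
      qed (use k in simp)
      ultimately show "i \<in> {i. 20 * M \<le> i \<and> i < 40 * M \<and> group_of i \<in> S}"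
        by simp
    qed
    have disjoint: "pieces_in k \<inter> pieces_in k' = {}" if "k \<in> S" "k' \<in> S" "k \<noteq> k'" for k k'
      using that pieces_in_base_len(3)[of k _ k'] by (force simp: S_def pieces_in_def meeting_def)
    have "card S * 190 \<le> (\<Sum>k\<in>S. card (pieces_in k))"
      using many sum_bounded_below[of S 190 "\<lambda>k. card (pieces_in k)"] by simp
    also have "\<dots> = card (\<Union>k\<in>S. pieces_in k)"
      by (rule card_UN_disjoint[symmetric]) (use fin finite_pieces_in disjoint in auto)
    also have "\<dots> \<le> card {i. 20 * M \<le> i \<and> i < 40 * M \<and> group_of i \<in> S}"
      using sub by (intro card_mono) auto
    also have "{i. 20 * M \<le> i \<and> i < 40 * M \<and> group_of i \<in> S}
        = (\<Union>k\<in>S. {i. 20 * M \<le> i \<and> i < 40 * M \<and> group_of i = k})"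
      by auto
    also have "\<dots> = (\<Union>k\<in>S. {20 * M + 20 * k..<20 * M + 20 * k + 20})"
      using own_eq by (intro SUP_cong) (auto simp: S_def)
    also have "card \<dots> \<le> (\<Sum>k\<in>S. card {20 * M + 20 * k..<20 * M + 20 * k + 20})"
      by (rule card_UN_le[OF fin])
    also have "\<dots> = card S * 20"
      by simp
    finally have "card S = 0"
      by simp
    with fin ne show False
      by simp
  qed
  then show ?thesis
    using assms by (force simp: S_def)
qed

text \<open>A player of another group would value such a piece at its length, at most
  \<open>level\<close> and hence below the \<open>best\<close> of its own group.\<close>

lemma pieces_in_players:
  assumes "k < M" "i \<in> pieces_in k"
  shows "i < 20 * M \<or> i \<in> {20 * M + 20 * k..<20 * M + 20 * k + 20}"
proof (rule ccontr)
  assume *: "\<not> ?thesis"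
  then have i: "20 * M \<le> i" "i < 40 * M" "i < n"
    using pieces_in_base_len(4)[OF assms] by auto
  then have "group_of i \<noteq> k"
    using * unfolding own_eq[OF assms(1), symmetric] by simp
  then have "group_value (group_of i) i = base_len i"
    using assms group_of_less[OF i(1,2)] by (intro pieces_in_value[of k]) auto
  then show False
    using group_value_own[OF i(1,2)] best_gt_level[OF group_of_less[OF i(1,2)]] base_len_le[OF i(3)] by simp
qed

text \<open>Such a trace contains a cluster, and \<open>10 * (101 / 100) + 30 > 40\<close>.\<close>

lemma long_value:
  assumes "k < M" "i < n" "101 / 100 \<le> group_len k i"
  shows "40 < base_len i + 9 * group_len k i + 30 * cluster_mass k i" "40 < 10 * group_len k i + 30 * cluster_mass k i"
proof -
  let ?c = "clip (real (40 * k)) (real (40 * k) + 40)"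
  have "1 \<le> clusters k (?c (r i)) - clusters k (?c (l i))"
    using assms(3) by (intro clusters_long) (auto simp: clip_def group_len_def ramp_def)
  then have "1 \<le> cluster_mass k i"
    unfolding clusters_clip cluster_mass_def .
  then show "40 < base_len i + 9 * group_len k i + 30 * cluster_mass k i" "40 < 10 * group_len k i + 30 * cluster_mass k i"
    using group_len_le_base_len[OF assms(1,2)] assms(3) by linarith+
qed

text \<open>It suffices that some piece meets the group in length \<open>101 / 100\<close>.
  Otherwise no common piece fits inside, and the 20 own players with two crossing pieces cover less
  than \<open>22 * 101 / 100\<close>.\<close>

lemma best_gt_40:
  assumes "k < M"
  shows "40 < best k"
proof -
  have "\<exists>i<n. 101 / 100 \<le> group_len k i"
  proof (rule ccontr)
    assume *: "\<not> ?thesis"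
    have "pieces_in k \<subseteq> {20 * M + 20 * k..<20 * M + 20 * k + 20}"
    proof
      fix i
      assume i: "i \<in> pieces_in k"
      then have "\<not> i < 20 * M"
        using * base_len_U[of i] pieces_in_base_len(1)[OF assms i] level_bounds by (auto simp: pieces_in_def meeting_def)
      then show "i \<in> {20 * M + 20 * k..<20 * M + 20 * k + 20}"
        using pieces_in_players[OF assms i] by blast
    qed
    from card_mono[OF _ this] have "card (meeting k) \<le> 22"
      using card_meeting_le[of k] by simp
    moreover have "40 \<le> real (card (meeting k)) * (101 / 100)"
      using * assms by (intro meeting_bound) (auto simp: meeting_def)
    ultimately show False
      by linarith
  qed
  then obtain i where i: "i < n" "101 / 100 \<le> group_len k i"
    by blast
  then show ?thesis
    using long_value(1)[OF assms i] group_value_le_best[OF assms i(1)] nonneg(4)[OF i(1), of k]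
    unfolding group_value_def by linarith
qed

text \<open>A shorter piece meets the group in at most one cluster's mass and is worth less than
  \<open>10 * (99 / 100) + 30 < 40\<close>.\<close>

lemma base_len_P:
  assumes "20 * M \<le> i" "i < 40 * M" "cell_len (group_of i) i = 0"
  shows "99 / 100 \<le> base_len i"
proof (rule ccontr)
  assume *: "\<not> 99 / 100 \<le> base_len i"
  define k where "k = group_of i"
  have k: "k < M" "i < n"
    using group_of_less[OF assms(1,2)] assms by (auto simp: k_def)
  let ?c = "clip (real (40 * k)) (real (40 * k) + 40)"
  have "group_len k i \<le> 99 / 100"
    using * group_len_le_base_len[OF k] by linarith
  then have "clusters k (?c (r i)) - clusters k (?c (l i)) \<le> 1"
    using ord[OF k(2)] monoD[OF mono_clip] by (intro clusters_short) (auto simp: group_len_def ramp_def)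
  then have "cluster_mass k i \<le> 1"
    unfolding clusters_clip cluster_mass_def .
  moreover have "40 < group_value k i"
    using best_gt_40[OF k(1)] group_value_own[OF assms(1,2)] by (simp add: k_def)
  ultimately show False
    using * group_len_le_base_len[OF k] assms(3) unfolding group_value_def k_def by linarith
qed

text \<open>A piece reaching the cell misses the group, so to exceed 40 it needs more than half of
  the cell, as \<open>level \<le> 41 / 20\<close>. Two players of one group cannot both have
  that.\<close>

lemma inj_cell_len: "inj_on group_of {i. 20 * M \<le> i \<and> i < 40 * M \<and> cell_len (group_of i) i \<noteq> 0}"
proof (rule inj_onI, rule ccontr)
  fix i j
  assume i: "i \<in> {i. 20 * M \<le> i \<and> i < 40 * M \<and> cell_len (group_of i) i \<noteq> 0}"
    and j: "j \<in> {i. 20 * M \<le> i \<and> i < 40 * M \<and> cell_len (group_of i) i \<noteq> 0}"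
    and eq: "group_of i = group_of j" and ne: "i \<noteq> j"
  define k where "k = group_of i"
  have k: "k < M" and ij: "i < n" "j < n"
    using i j group_of_less[of i] by (auto simp: k_def)
  have val: "40 < base_len p + 65 * cell_len k p" if "p \<in> {i, j}" for p
  proof -
    have p: "20 * M \<le> p" "p < 40 * M" "group_of p = k" "p < n" "cell_len k p \<noteq> 0"
      using that i j eq by (auto simp: k_def)
    then have "0 < cell_len k p"
      using nonneg(4)[of p k] by simp
    then have "group_len k p = 0"
      by (rule cell_len_outside_group[OF p(4) k k])
    then show ?thesis
      using group_value_own[OF p(1,2)] best_gt_40[OF k] outside_group[OF p(4)] p(3) by (simp add: group_value_def)
  qed
  have "cell_len k i + cell_len k j = (\<Sum>p\<in>{i, j}. cell_len k p)"
    using ne by simp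
  also have "\<dots> \<le> (\<Sum>p<n. cell_len k p)"
    using ij by (intro sum_mono2) (auto simp: nonneg)
  also have "\<dots> = 1"
    by (rule sum_cell_len[OF k])
  finally show False
    using val[of i] val[of j] base_len_le[OF ij(1)] base_len_le[OF ij(2)] level_bounds by simp
qed

text \<open>At least \<open>19 * M\<close> group players hold length \<open>99 / 100\<close> each,
  leaving at most \<open>(41 - 19 * 99 / 100) * M\<close> for the \<open>20 * M\<close> common
  pieces.\<close>

lemma level_le: "level \<le> 111 / 100"
proof -
  let ?P = "{i. 20 * M \<le> i \<and> i < 40 * M}"
  let ?B = "{i. 20 * M \<le> i \<and> i < 40 * M \<and> cell_len (group_of i) i \<noteq> 0}"
  have "?P = {20 * M..<40 * M}"
    by auto
  then have P: "card ?P = 20 * M"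
    by simp
  have finB: "finite ?B"
    by auto
  have "card ?B \<le> card {..<M}"
    using group_of_less by (intro card_inj_on_le[OF inj_cell_len]) auto
  then have "19 * M \<le> card (?P - ?B)"
    using P finB by (subst card_Diff_subset) auto
  then have "real M * (19 * (99 / 100)) \<le> real (card (?P - ?B)) * (99 / 100)"
    by linarith
  also have "\<dots> \<le> (\<Sum>i\<in>?P - ?B. base_len i)"
    using base_len_P by (intro sum_bounded_below) auto
  finally have *: "real M * (19 * (99 / 100)) \<le> (\<Sum>i\<in>?P - ?B. base_len i)" .
  have "real M * (20 * level) = (\<Sum>i<20 * M. base_len i)"
    using base_len_U by simp
  with * have "real M * (20 * level + 19 * (99 / 100)) \<le> (\<Sum>i<20 * M. base_len i) + (\<Sum>i\<in>?P - ?B. base_len i)"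
    by (simp add: distrib_left)
  also have "\<dots> = (\<Sum>i\<in>{..<20 * M} \<union> (?P - ?B). base_len i)"
    by (rule sum.union_disjoint[symmetric]) auto
  also have "\<dots> \<le> (\<Sum>i<n. base_len i)"
    by (intro sum_mono2) (auto simp: nonneg)
  finally have "real M * (20 * level + 19 * (99 / 100)) \<le> real M * 41"
    by (simp add: sum_base_len)
  then have "20 * level + 19 * (99 / 100) \<le> 41"
    using M4 by (subst (asm) mult_le_cancel_left_pos) auto
  then show ?thesis
    by simp
qed

text \<open>Otherwise the 20 own players all need value 65 without the cell, so all meet the group
  and at least 18 have pieces inside. At most 10 common pieces can join them, and the resulting 32
  pieces of length at most \<open>111 / 100\<close> do not cover length 40.\<close>

lemma no_full_cell_len:
  assumes k: "k < M" and i: "40 * M \<le> i" "i < n"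
  shows "cell_len k i < 1"
proof (rule ccontr)
  assume "\<not> cell_len k i < 1"
  then have full: "1 \<le> cell_len k i"
    by simp
  let ?own = "{20 * M + 20 * k..<20 * M + 20 * k + 20}"
  have own: "20 * M \<le> j" "j < 40 * M" "j < n" "group_of j = k" "cell_len k j = 0" if "j \<in> ?own" for j
  proof -
    show j: "20 * M \<le> j" "j < 40 * M" "group_of j = k" "j < n"
      using that unfolding own_eq[OF k, symmetric] by simp_all
    then have "cell_len k i + cell_len k j = (\<Sum>p\<in>{i, j}. cell_len k p)"
      using i by simp
    also have "\<dots> \<le> (\<Sum>p<n. cell_len k p)"
      using i j by (intro sum_mono2) (auto simp: nonneg)
    also have "\<dots> = 1"
      by (rule sum_cell_len[OF k])
    finally show "cell_len k j = 0"
      using full nonneg(4)[OF j(4), of k] by linarith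
  qed
  have "65 * 1 \<le> group_value k i"
    using nonneg(1)[OF i(2)] nonneg(2-4)[OF i(2), of k] full unfolding group_value_def by linarith
  then have best65: "65 \<le> best k"
    using group_value_le_best[OF k i(2)] by linarith
  have own65: "65 \<le> base_len j + 9 * group_len k j + 30 * cluster_mass k j" if "j \<in> ?own" for j
    using own[OF that] group_value_own[OF own(1,2)[OF that]] best65 by (simp add: group_value_def)
  have "?own \<subseteq> meeting k"
  proof
    fix j
    assume j: "j \<in> ?own"
    have "group_len k j \<noteq> 0"
      using own65[OF j] outside_group[OF own(3)[OF j], of k] base_len_le[OF own(3)[OF j]] level_bounds by auto
    then show "j \<in> meeting k"
      using own(3)[OF j] nonneg(2)[OF own(3)[OF j], of k] by (simp add: meeting_def)
  qed
  then have own18: "18 \<le> card (?own \<inter> pieces_in k)"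
    using card_meeting_Int_le[of ?own k] by (simp add: Int_absorb2)
  define c where "c = card ({..<20 * M} \<inter> pieces_in k)"
  \<comment> \<open>The budget of the group is \<open>10 * 40 + 30 * 40 = 1600\<close>. Own pieces
    inside use 65 each and common ones 40 each; \<open>18 * 65 = 1170\<close> leaves room for at
    most 10 common ones.\<close>
  let ?f = "\<lambda>j. 10 * group_len k j + 30 * cluster_mass k j"
  have "real (card (?own \<inter> pieces_in k)) * 65 \<le> (\<Sum>j\<in>?own \<inter> pieces_in k. ?f j)"
    using own65 pieces_in_base_len(1)[OF k] by (intro sum_bounded_below) force
  moreover have "real c * 40 \<le> (\<Sum>j\<in>{..<20 * M} \<inter> pieces_in k. ?f j)"
    unfolding c_def
  proof (rule sum_bounded_below)
    fix j
    assume j: "j \<in> {..<20 * M} \<inter> pieces_in k"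
    then have "group_len k j = level"
      using pieces_in_base_len(1)[OF k, of j] base_len_U[of j] by simp
    then show "40 \<le> ?f j"
      using long_value(2)[OF k, of j] j level_bounds by simp
  qed
  moreover have "(\<Sum>j\<in>?own \<inter> pieces_in k. ?f j) + (\<Sum>j\<in>{..<20 * M} \<inter> pieces_in k. ?f j)
      = (\<Sum>j\<in>(?own \<inter> pieces_in k) \<union> ({..<20 * M} \<inter> pieces_in k). ?f j)"
    by (rule sum.union_disjoint[symmetric]) (auto simp: finite_pieces_in)
  moreover have "\<dots> \<le> (\<Sum>j<n. ?f j)"
    by (intro sum_mono2) (auto simp: pieces_in_def meeting_def nonneg)
  moreover have "(\<Sum>j<n. ?f j) = 1600"
    using sum_group_len[OF k] sum_cluster_mass[OF k] by (simp add: sum.distrib flip: sum_distrib_left)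
  ultimately have "real (card (?own \<inter> pieces_in k)) * 65 + real c * 40 \<le> 1600"
    by linarith
  with own18 have c: "c \<le> 10"
    by linarith
  have "pieces_in k \<subseteq> ?own \<union> ({..<20 * M} \<inter> pieces_in k)"
    using pieces_in_players[OF k] by blast
  then have "card (pieces_in k) \<le> card (?own \<union> ({..<20 * M} \<inter> pieces_in k))"
    by (intro card_mono) (auto simp: finite_pieces_in)
  also have "\<dots> \<le> card ?own + c"
    unfolding c_def by (rule card_Un_le)
  finally have "card (meeting k) \<le> 32"
    using card_meeting_le[of k] c by simp
  then have "real (card (meeting k)) * (111 / 100) < 40"
    by linarith
  moreover have "40 \<le> real (card (meeting k)) * (111 / 100)"
  proof (rule meeting_bound[OF k])
    fix j
    assume "j \<in> meeting k"
    then show "group_len k j \<le> 111 / 100"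
      using group_len_le_base_len[OF k, of j] base_len_le[of j] level_le by (auto simp: meeting_def)
  qed
  ultimately show False
    by simp
qed

text \<open>More than length 2 of a run would include a whole cell, starting at the first cell
  boundary at or after \<open>s\<close>.\<close>

lemma value_R:
  assumes j: "j < m"
  shows "player_cdf m (40 * M + j) (r (40 * M + j)) - player_cdf m (40 * M + j) (l (40 * M + j)) \<le> 2"
proof (rule ccontr)
  assume "\<not> ?thesis"
  define i where "i = 40 * M + j"
  define a where "a = 41 * real M + real (j * m)"
  define s where "s = clip a (a + real m) (l i)"
  define t where "t = clip a (a + real m) (r i)"
  have i: "40 * M \<le> i" "i < n"
    using j by (auto simp: i_def)
  have "player_cdf m i = ramp a (a + real m)"
    by (auto simp: player_cdf_def Let_def fun_eq_iff i_def a_def simp flip: M_def)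
  with \<open>\<not> ?thesis\<close> have long: "s + 2 < t"
    by (simp add: i_def[symmetric] ramp_def s_def t_def)
  have st: "a \<le> s" "t \<le> a + real m"
    by (auto simp: s_def t_def clip_def)
  define c where "c = nat \<lceil>s - a\<rceil>"
  have c: "s \<le> a + real c" "a + real c < s + 1"
    using st(1) unfolding c_def by linarith+
  have "c < m"
    using c st long by linarith
  have "Suc j * m \<le> m * m"
    using j by (intro mult_le_mono1) simp
  then have "j * m + c < M"
    using \<open>c < m\<close> by (simp add: M_def)
  moreover have "cell_len (j * m + c) i = 1"
  proof -
    have "l i \<le> s" "t \<le> r i"
      using long st by (auto simp: s_def t_def clip_def)
    then show ?thesis
      using c long ord[OF i(2)] by (simp add: cell_len_def ramp_def clip_def a_def)
  qed
  ultimately show False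
    using no_full_cell_len[of "j * m + c" i] i by simp
qed

text \<open>\<open>41 / 20 + 9 * 40 + 30 * 40 + 65 < 1628\<close>. This crude bound suffices because
  the total value exceeds \<open>41 * M\<close>.\<close>

lemma value_P:
  assumes "20 * M \<le> i" "i < 40 * M"
  shows "player_cdf m i (r i) - player_cdf m i (l i) \<le> 1628"
proof -
  define k where "k = group_of i"
  have k: "k < M" and i: "i < n"
    using group_of_less[OF assms] assms by (auto simp: k_def)
  have "group_len k i \<le> 40" "cluster_mass k i \<le> 40" "cell_len k i \<le> 1"
    using sum_group_len[OF k] sum_cluster_mass[OF k] sum_cell_len[OF k] nonneg i
      member_le_sum[of i "{..<n}" "group_len k"] member_le_sum[of i "{..<n}" "cluster_mass k"] member_le_sum[of i "{..<n}" "cell_len k"]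
    by auto
  then show ?thesis
    using base_len_le[OF i] level_bounds unfolding player_P[OF assms] group_value_def k_def by linarith
qed

text \<open>Common players share at most the length \<open>41 * M\<close>, giving 1 in all. The
  \<open>20 * M\<close> group players get at most \<open>1628 / (41 * M)\<close> each, below 800 in
  all, and the \<open>m\<close> rich players at most \<open>2 / m\<close> each.\<close>

lemma welfare_le:
  "(\<Sum>i<n. (player_cdf m i (r i) - player_cdf m i (l i)) / player_cdf m i (42 * real M)) \<le> 803"
proof -
  let ?u = "\<lambda>i. (player_cdf m i (r i) - player_cdf m i (l i)) / player_cdf m i (42 * real M)"
  have "(\<Sum>i<20 * M. ?u i) \<le> 1"
  proof -
    have "(\<Sum>i<20 * M. ?u i) = (\<Sum>i<20 * M. base_len i) / (41 * real M)"
      by (simp add: player_U player_cdf_total[OF M_def] sum_divide_distrib)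
    also have "\<dots> \<le> (\<Sum>i<n. base_len i) / (41 * real M)"
      by (intro divide_right_mono sum_mono2) (auto simp: nonneg)
    finally show ?thesis
      using M4 unfolding sum_base_len by simp
  qed
  moreover have "(\<Sum>i=20 * M..<40 * M. ?u i) \<le> 800"
  proof -
    have "?u i \<le> 1628 / (41 * real M)" if "i \<in> {20 * M..<40 * M}" for i
      using that value_P[of i] M4 by (intro frac_le) (auto simp: player_cdf_total[OF M_def])
    from sum_bounded_above[of "{20 * M..<40 * M}" ?u, OF this]
    have "(\<Sum>i=20 * M..<40 * M. ?u i) \<le> real (20 * M) * (1628 / (41 * real M))"
      by simp
    also have "\<dots> \<le> 800"
      using M4 by simp
    finally show ?thesis .
  qed
  moreover have "(\<Sum>i=40 * M..<n. ?u i) \<le> 2"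
  proof -
    have "?u i \<le> 2 / real m" if "i \<in> {40 * M..<n}" for i
      using that value_R[of "i - 40 * M"] by (auto simp: player_cdf_total[OF M_def] intro!: divide_right_mono)
    from sum_bounded_above[of "{40 * M..<n}" ?u, OF this]
    have "(\<Sum>i=40 * M..<n. ?u i) \<le> real m * (2 / real m)"
      by simp
    then show ?thesis
      using m2 by simp
  qed
  moreover have "(\<Sum>i<n. ?u i) = (\<Sum>i<20 * M. ?u i) + (\<Sum>i=20 * M..<40 * M. ?u i) + (\<Sum>i=40 * M..<n. ?u i)"
    by (simp add: sum.atLeastLessThan_concat lessThan_atLeast0)
  ultimately show ?thesis
    by linarith
qed

end

section \<open>The dumping instance\<close>

definition dump_valuation :: "nat \<Rightarrow> nat \<Rightarrow> real measure" where
  "dump_valuation m i =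
    cdf_measure (\<lambda>t. player_cdf m i (42 * real (m * m) * t) / player_cdf m i (42 * real (m * m)))"

text \<open>Left ends of the partial division, in units. Common players get the odd unit intervals,
  free of clusters; group players the even ones, each with two clusters of the own group; rich
  players their runs.\<close>

definition home_left :: "nat \<Rightarrow> nat \<Rightarrow> real" where
  "home_left m i =
     (if i < 20 * (m * m) then real (2 * i + 1)
      else if i < 40 * (m * m) then real (2 * (i - 20 * (m * m)))
      else 41 * real (m * m) + real ((i - 40 * (m * m)) * m))"

definition home_right :: "nat \<Rightarrow> nat \<Rightarrow> real" where
  "home_right m i = home_left m i + (if i < 40 * (m * m) then 1 else real m)"

definition dump_division :: "nat \<Rightarrow> nat \<Rightarrow> real \<times> real" where
  "dump_division m i = (home_left m i / (42 * real (m * m)), home_right m i / (42 * real (m * m)))"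

context
  fixes m M :: nat
  assumes m0: "0 < m" and M_eq: "M = m * m"
begin

lemma M_pos: "0 < M"
  using m0 by (simp add: M_eq)

lemma total_pos: "i < 40 * M + m \<Longrightarrow> 0 < player_cdf m i (42 * real M)"
  using player_cdf_total[OF M_eq, of i] M_pos m0
  by (cases "i < 20 * M"; cases "i < 40 * M") auto

lemma continuous_scaled_cdf:
  assumes "continuous_on UNIV F"
  shows "continuous_on UNIV (\<lambda>t. F (42 * real M * t) / (c::real))"
proof -
  have "continuous_on UNIV (\<lambda>t. F (42 * real M * t))"
    by (intro continuous_on_compose2[OF assms] continuous_intros) auto
  then show ?thesis
    unfolding divide_inverse by (intro continuous_intros)
qed

lemma mono_scaled_cdf:
  fixes F :: "real \<Rightarrow> real"
  assumes "mono F" "0 < c"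
  shows "mono (\<lambda>t. F (42 * real M * t) / c)"
  using assms(2) by (intro monoI divide_right_mono monoD[OF assms(1)] mult_left_mono) auto

lemma valuation_dump:
  assumes "i < 40 * M + m"
  shows "valuation (dump_valuation m i)"
  unfolding dump_valuation_def M_eq[symmetric]
  using total_pos[OF assms]
  by (intro valuation_cdf_measure continuous_scaled_cdf continuous_player_cdf mono_scaled_cdf mono_player_cdf)
    (auto simp: player_cdf_0)

lemma cake_instance_dump: "cake_instance (40 * M + m) (dump_valuation m)"
  using valuation_dump by (simp add: cake_instance_def)

lemma util_dump:
  assumes "division (40 * M + m) x" "i < 40 * M + m" "j < 40 * M + m"
  shows "util (dump_valuation m) x i j =
    (player_cdf m i (42 * real M * snd (x j)) - player_cdf m i (42 * real M * fst (x j))) / player_cdf m i (42 * real M)"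
proof -
  have "0 \<le> fst (x j)" "fst (x j) \<le> snd (x j)" "snd (x j) \<le> 1"
    using assms by (auto simp: division_def)
  then show ?thesis
    unfolding util_def piece_def dump_valuation_def M_eq[symmetric]
    using total_pos[OF assms(2)]
    by (subst measure_cdf_measure)
      (auto intro!: continuous_scaled_cdf continuous_player_cdf mono_scaled_cdf mono_player_cdf
        simp: diff_divide_distrib)
qed

lemma complete_welfare_le:
  assumes m2: "2 \<le> m" and x: "complete_div (40 * M + m) x" and ef: "envy_free (40 * M + m) (dump_valuation m) x"
  shows "utilitarian (40 * M + m) (dump_valuation m) x \<le> 803"
proof -
  let ?n = "40 * M + m"
  define l where "l i = 42 * real M * fst (x i)" for i
  define r where "r i = 42 * real M * snd (x i)" for i
  have div: "division ?n x"
    using x by (simp add: complete_div_def)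
  \<comment> \<open>The factor \<open>42 * real M\<close> turns the cake into units;
    \<open>cover\<close> is the mass identity for the rescaled \<open>F\<close>.\<close>
  interpret unit_division m M l r
  proof
    show "2 \<le> m" "M = m * m"
      by (fact m2, fact M_eq)
    show "0 \<le> l i \<and> l i \<le> r i \<and> r i \<le> 42 * real M" if "i < ?n" for i
    proof -
      have "0 \<le> fst (x i)" "fst (x i) \<le> snd (x i)" "snd (x i) \<le> 1"
        using div that by (auto simp: division_def)
      then show ?thesis
        using mult_left_mono[of "snd (x i)" 1 "42 * real M"] by (auto simp: l_def r_def intro: mult_left_mono)
    qed
    show "{l i<..<r i} \<inter> {l j<..<r j} = {}" if "i < ?n" "j < ?n" "i \<noteq> j" for i j
    proof -
      have "piece x i \<inter> piece x j = {}"
        using div that by (simp add: division_def)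
      from disjoint_intervals[OF this[unfolded piece_def]]
      have "r i \<le> l i \<or> r j \<le> l j \<or> r i \<le> l j \<or> r j \<le> l i"
        by (auto simp: l_def r_def intro!: mult_left_mono)
      then show ?thesis
        by auto
    qed
    show "(\<Sum>i<?n. F (r i) - F (l i)) = F (42 * real M) - F 0"
      if "continuous_on UNIV F" "mono F" for F :: "real \<Rightarrow> real"
      using complete_div_sum_eq[OF continuous_scaled_cdf[OF that(1), of 1] mono_scaled_cdf[OF that(2), of 1] x]
      by (simp add: l_def r_def)
    show "player_cdf m i (r j) - player_cdf m i (l j) \<le> player_cdf m i (r i) - player_cdf m i (l i)"
      if "i < ?n" "j < ?n" for i j
    proof -
      have "util (dump_valuation m) x i j \<le> util (dump_valuation m) x i i"
        using ef that by (simp add: envy_free_def)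
      then show ?thesis
        using total_pos[OF that(1)]
        by (simp add: util_dump[OF div] that l_def r_def divide_le_cancel)
    qed
  qed
  have "utilitarian ?n (dump_valuation m) x =
      (\<Sum>i<?n. (player_cdf m i (r i) - player_cdf m i (l i)) / player_cdf m i (42 * real M))"
    unfolding utilitarian_def by (intro sum.cong) (simp_all add: util_dump[OF div] l_def r_def)
  with welfare_le show ?thesis
    by simp
qed

text \<open>Parity tells common from group players and \<open>z div 2\<close> recovers the position
  within the kind, so distinct players have distinct \<open>z\<close>.\<close>

lemma home_unit:
  assumes "i < 40 * M"
  obtains z where "home_left m i = real z" "home_right m i = real z + 1" "z < 40 * M"
    "i < 20 * M \<longleftrightarrow> odd z" "z div 2 = (if i < 20 * M then i else i - 20 * M)"
proof (cases "i < 20 * M")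
  case True
  then show thesis
    by (intro that[of "2 * i + 1"]) (auto simp: home_left_def home_right_def simp flip: M_eq)
next
  case False
  then show thesis
    using assms by (intro that[of "2 * (i - 20 * M)"]) (auto simp: home_left_def home_right_def simp flip: M_eq)
qed

lemma home_reserved:
  assumes "40 * M \<le> i" "i < 40 * M + m"
  shows "home_left m i = 41 * real M + real ((i - 40 * M) * m)" "home_right m i = home_left m i + real m"
    "41 * real M \<le> home_left m i" "home_right m i \<le> 42 * real M"
proof -
  show l: "home_left m i = 41 * real M + real ((i - 40 * M) * m)" and r: "home_right m i = home_left m i + real m"
    using assms by (auto simp: home_left_def home_right_def simp flip: M_eq)
  then show "41 * real M \<le> home_left m i"
    by simp
  have "Suc (i - 40 * M) * m \<le> m * m"
    using assms by (intro mult_le_mono1) simp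
  then have "(i - 40 * M) * m + m \<le> M"
    by (simp add: M_eq)
  then have "real ((i - 40 * M) * m) + real m \<le> real M"
    by (metis of_nat_add of_nat_mono)
  then show "home_right m i \<le> 42 * real M"
    unfolding r l by simp
qed

lemma home_disjoint:
  assumes "i < 40 * M + m" "j < 40 * M + m" "i \<noteq> j"
  shows "home_right m i \<le> home_left m j \<or> home_right m j \<le> home_left m i"
proof -
  have mixed: "home_right m i \<le> home_left m j" if ij: "i < 40 * M" "40 * M \<le> j" "j < 40 * M + m" for i j
  proof -
    obtain z where z: "home_right m i = real z + 1" "z < 40 * M"
      using home_unit[OF ij(1)] by metis
    then have "home_right m i \<le> 40 * real M"
      by linarith
    then show ?thesis
      using home_reserved(3)[OF ij(2,3)] by linarith
  qed
  consider "i < 40 * M" "j < 40 * M" | "i < 40 * M" "40 * M \<le> j" | "40 * M \<le> i" "j < 40 * M"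
    | "40 * M \<le> i" "40 * M \<le> j"
    by linarith
  then show ?thesis
  proof cases
    case 1
    obtain y where y: "home_left m i = real y" "home_right m i = real y + 1" "i < 20 * M \<longleftrightarrow> odd y"
        "y div 2 = (if i < 20 * M then i else i - 20 * M)"
      by (rule home_unit[OF 1(1)])
    obtain z where z: "home_left m j = real z" "home_right m j = real z + 1" "j < 20 * M \<longleftrightarrow> odd z"
        "z div 2 = (if j < 20 * M then j else j - 20 * M)"
      by (rule home_unit[OF 1(2)])
    have "y \<noteq> z"
      using y z assms(3) by (auto split: if_splits)
    then have "real y + 1 \<le> real z \<or> real z + 1 \<le> real y"
      by linarith
    then show ?thesis
      by (simp add: y z)
  next
    case 4
    have step: "a * m + m \<le> b * m" if "a < b" for a b :: nat
      using that mult_le_mono1[of "Suc a" b m] by simp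
    have "i - 40 * M < j - 40 * M \<or> j - 40 * M < i - 40 * M"
      using 4 assms by linarith
    then have "(i - 40 * M) * m + m \<le> (j - 40 * M) * m \<or> (j - 40 * M) * m + m \<le> (i - 40 * M) * m"
      using step by blast
    then have "real ((i - 40 * M) * m) + real m \<le> real ((j - 40 * M) * m)
        \<or> real ((j - 40 * M) * m) + real m \<le> real ((i - 40 * M) * m)"
      by (metis of_nat_add of_nat_mono)
    then show ?thesis
      using home_reserved(1,2)[OF 4(1) assms(1)] home_reserved(1,2)[OF 4(2) assms(2)] by auto
  qed (use mixed assms in blast)+
qed

lemma home_bounds:
  assumes "i < 40 * M + m"
  shows "0 \<le> home_left m i" "home_left m i \<le> home_right m i" "home_right m i \<le> 42 * real M"
    "home_right m i \<le> 40 * real M \<or> 41 * real M \<le> home_left m i"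
proof -
  have "0 \<le> home_left m i \<and> home_left m i \<le> home_right m i \<and> home_right m i \<le> 42 * real M \<and>
      (home_right m i \<le> 40 * real M \<or> 41 * real M \<le> home_left m i)"
  proof (cases "i < 40 * M")
    case True
    obtain z where "home_left m i = real z" "home_right m i = real z + 1" "z < 40 * M"
      by (rule home_unit[OF True])
    then show ?thesis
      by auto
  next
    case False
    then show ?thesis
      using home_reserved[of i] assms by auto
  qed
  then show "0 \<le> home_left m i" "home_left m i \<le> home_right m i" "home_right m i \<le> 42 * real M"
    "home_right m i \<le> 40 * real M \<or> 41 * real M \<le> home_left m i"
    by auto
qed

text \<open>A cluster lies within \<open>1 / 200\<close> of its integer \<open>40 * k + c\<close>,
  so only those attached to the two ends can meet a unit interval.\<close>

lemma clusters_unit_le: "clusters k (real z + 1) - clusters k (real z) \<le> 2"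
proof -
  define T where "T = {c. 40 * k + c = z \<or> 40 * k + c = Suc z}"
  have "T \<subseteq> {z - 40 * k, Suc z - 40 * k}"
    by (auto simp: T_def)
  then have "finite T" "card T \<le> card {z - 40 * k, Suc z - 40 * k}"
    by (auto intro: finite_subset card_mono)
  moreover have "card {z - 40 * k, Suc z - 40 * k} \<le> 2"
    by (simp add: card_insert_if)
  moreover have "real z + 1 \<le> cluster_pos k c \<or> cluster_pos k c + 1 / 200 \<le> real z" if "c \<notin> T" for c
  proof -
    have "z + 2 \<le> 40 * k + c \<or> 40 * k + c + 1 \<le> z"
      using that by (auto simp: T_def)
    then have "real z + 2 \<le> real (40 * k + c) \<or> real (40 * k + c) + 1 \<le> real z"
      by linarith
    then show ?thesis
      by (auto simp: cluster_pos_def)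
  qed
  ultimately have "card T \<le> 2" "clusters k (real z + 1) - clusters k (real z) \<le> real (card T)"
    using clusters_diff_le_card[of "real z" "real z + 1" T k] by auto
  then show ?thesis
    by simp
qed

lemma home_envy_free:
  assumes i: "i < 40 * M + m" and j: "j < 40 * M + m"
  shows "player_cdf m i (home_right m j) - player_cdf m i (home_left m j)
    \<le> player_cdf m i (home_right m i) - player_cdf m i (home_left m i)"
proof -
  consider "i < 20 * M" | "20 * M \<le> i" "i < 40 * M" | "40 * M \<le> i"
    by linarith
  then show ?thesis
  proof cases
    case 1
    then obtain z where z: "home_left m i = real z" "home_right m i = real z + 1" "z < 40 * M"
      using home_unit[of i] by auto
    have pc: "player_cdf m i = ramp 0 (41 * real M)"
      using 1 by (simp add: player_cdf_def fun_eq_iff flip: M_eq)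
    have "player_cdf m i (home_right m j) - player_cdf m i (home_left m j) \<le> 1"
    proof (cases "j < 40 * M")
      case True
      then obtain z where "home_left m j = real z" "home_right m j = real z + 1" "z < 40 * M"
        by (rule home_unit)
      then show ?thesis
        by (simp add: pc ramp_def clip_def)
    next
      case False
      then show ?thesis
        using home_reserved[of j] j by (simp add: pc ramp_def clip_def)
    qed
    also have "1 = player_cdf m i (home_right m i) - player_cdf m i (home_left m i)"
      using z by (simp add: pc ramp_def clip_def)
    finally show ?thesis .
  next
    case 2
    define k where "k = (i - 20 * M) div 20"
    define g where "g = (i - 20 * M) mod 20"
    have k: "k < M"
      unfolding k_def using 2 by (intro div_less_iff_less_mult[THEN iffD2]) auto
    define v where "v s t = (ramp 0 (41 * real M) t - ramp 0 (41 * real M) s)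
        + 9 * (ramp (real (40 * k)) (real (40 * k) + 40) t - ramp (real (40 * k)) (real (40 * k) + 40) s)
        + 30 * (clusters k t - clusters k s)
        + 65 * (ramp (41 * real M + real k) (41 * real M + real k + 1) t - ramp (41 * real M + real k) (41 * real M + real k + 1) s)"
      for s t
    have pc: "player_cdf m i t - player_cdf m i s = v s t" for s t
      using 2 by (simp add: player_cdf_def Let_def v_def k_def algebra_simps flip: M_eq)
    \<comment> \<open>The own interval is worth \<open>1 + 9 + 2 * 30 = 70\<close>. Another unit
      interval has no larger parts, and a run offers at most one cell of mass 65.\<close>
    have combine_le: "a + 9 * b + 30 * c + 65 * d \<le> 70"
      if "a \<le> 1 \<and> b \<le> 1 \<and> c \<le> 2 \<and> d = 0 \<or> a = 0 \<and> b = 0 \<and> c = 0 \<and> d \<le> 1"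
      for a b c d :: real
      using that by auto
    have combine_ge: "70 \<le> a + 9 * b + 30 * c + 65 * d"
      if "a = 1" "b = 1" "2 \<le> c" "0 \<le> d" for a b c d :: real
      using that by auto
    have "v (home_left m j) (home_right m j) \<le> 70"
    proof (cases "j < 40 * M")
      case True
      then obtain z where z: "home_left m j = real z" "home_right m j = real z + 1" "z < 40 * M"
        by (rule home_unit)
      have "ramp 0 (41 * real M) (real z + 1) - ramp 0 (41 * real M) (real z) \<le> 1"
        "ramp (real (40 * k)) (real (40 * k) + 40) (real z + 1) - ramp (real (40 * k)) (real (40 * k) + 40) (real z) \<le> 1"
        "ramp (41 * real M + real k) (41 * real M + real k + 1) (real z + 1)
          - ramp (41 * real M + real k) (41 * real M + real k + 1) (real z) = 0"
        using z(3) by (auto simp: ramp_def clip_def)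
      then show ?thesis
        unfolding v_def z(1,2) using clusters_unit_le[of k z] by (intro combine_le) blast
    next
      case False
      have "real (40 * k) + 40 \<le> 41 * real M"
        using k by linarith
      then have lr: "41 * real M \<le> home_left m j" "home_left m j \<le> home_right m j"
          "real (40 * k) + 40 \<le> home_left m j"
        using home_reserved(2,3)[of j] False j by linarith+
      then have "ramp 0 (41 * real M) (home_right m j) - ramp 0 (41 * real M) (home_left m j) = 0"
        "ramp (real (40 * k)) (real (40 * k) + 40) (home_right m j)
          - ramp (real (40 * k)) (real (40 * k) + 40) (home_left m j) = 0"
        "clusters k (home_right m j) - clusters k (home_left m j) = 0"
        using clusters_right[of k "home_right m j"] clusters_right[of k "home_left m j"]
        by (auto simp: ramp_def clip_def)
      then show ?thesis
        unfolding v_def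
        using ramp_diff_le[of "41 * real M + real k" "41 * real M + real k + 1" "home_right m j" "home_left m j"]
        by (intro combine_le) auto
    qed
    also have "70 \<le> v (home_left m i) (home_right m i)"
    proof -
      define z where "z = 40 * k + 2 * g"
      have g: "g < 20" "i - 20 * M = 20 * k + g"
        by (auto simp: g_def k_def)
      then have z: "home_left m i = real z" "home_right m i = real z + 1" and zM: "z + 1 \<le> 40 * M"
        using 2 k by (auto simp: home_left_def home_right_def z_def simp flip: M_eq)
      have "real (card {2 * g, 2 * g + 1}) \<le> clusters k (real z + 1) - clusters k (real z)"
        using g by (intro card_le_clusters_diff) (auto simp: cluster_pos_def z_def)
      then have "2 \<le> clusters k (real z + 1) - clusters k (real z)"
        by simp
      moreover have "ramp 0 (41 * real M) (real z + 1) - ramp 0 (41 * real M) (real z) = 1"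
        using zM by (auto simp: ramp_def clip_def)
      moreover have "ramp (real (40 * k)) (real (40 * k) + 40) (real z + 1)
          - ramp (real (40 * k)) (real (40 * k) + 40) (real z) = 1"
        using g by (auto simp: ramp_def clip_def z_def)
      moreover have "ramp (41 * real M + real k) (41 * real M + real k + 1) (real z)
          \<le> ramp (41 * real M + real k) (41 * real M + real k + 1) (real z + 1)"
        by (intro ramp_mono) simp
      ultimately show ?thesis
        unfolding v_def z by (intro combine_ge) auto
    qed
    finally show ?thesis
      unfolding pc .
  next
    case 3
    define a where "a = 41 * real M + real ((i - 40 * M) * m)"
    have "player_cdf m i = ramp a (a + real m)"
      using 3 by (auto simp: player_cdf_def Let_def fun_eq_iff a_def simp flip: M_eq)
    then show ?thesis
      using home_reserved(1,2)[OF 3 i] ramp_diff_le[of a "a + real m" "home_right m j" "home_left m j"]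
      by (simp add: ramp_def clip_def a_def)
  qed
qed

section \<open>The envy-free partial division of the cake\<close>

lemma dump_division_scaled:
  "42 * real M * fst (dump_division m i) = home_left m i"
  "42 * real M * snd (dump_division m i) = home_right m i"
  using M_pos by (auto simp: dump_division_def simp flip: M_eq)

lemma division_dump: "division (40 * M + m) (dump_division m)"
proof -
  have "piece (dump_division m) i \<inter> piece (dump_division m) j = {}"
    if "i < 40 * M + m" "j < 40 * M + m" "i \<noteq> j" for i j
  proof -
    have "snd (dump_division m i) \<le> fst (dump_division m j) \<or> snd (dump_division m j) \<le> fst (dump_division m i)"
      using home_disjoint[OF that] unfolding dump_division_def by (auto intro!: divide_right_mono)
    then show ?thesis
      by (auto simp: piece_def)
  qed
  moreover have "0 \<le> fst (dump_division m i) \<and> fst (dump_division m i) \<le> snd (dump_division m i)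
      \<and> snd (dump_division m i) \<le> 1" if "i < 40 * M + m" for i
    using home_bounds[OF that] M_pos
    by (auto simp: dump_division_def divide_right_mono simp flip: M_eq)
  ultimately show ?thesis
    unfolding division_def by blast
qed

lemma partial_div_dump: "partial_div (40 * M + m) (dump_division m)"
proof -
  \<comment> \<open>A point inside the dump: \<open>40 * M + 1 / 2 < 41 * M\<close>, and no home
    interval reaches into the dump.\<close>
  define t where "t = (40 * real M + 1 / 2) / (42 * real M)"
  have t: "42 * real M * t = 40 * real M + 1 / 2"
    using M_pos by (simp add: t_def)
  have "t \<notin> closure (piece (dump_division m) i)" if i: "i < 40 * M + m" for i
  proof
    assume "t \<in> closure (piece (dump_division m) i)"
    moreover have "closure (piece (dump_division m) i) \<subseteq> {fst (dump_division m i)..snd (dump_division m i)}"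
      by (intro closure_minimal) (auto simp: piece_def)
    ultimately have "42 * real M * fst (dump_division m i) \<le> 42 * real M * t"
        "42 * real M * t \<le> 42 * real M * snd (dump_division m i)"
      by (auto intro!: mult_left_mono)
    then show False
      using home_bounds(4)[OF i] M_pos unfolding t dump_division_scaled by linarith
  qed
  moreover have "t \<in> {0..1}"
    using M_pos by (auto simp: t_def)
  ultimately show ?thesis
    using division_dump unfolding partial_div_def by blast
qed

lemma envy_free_dump: "envy_free (40 * M + m) (dump_valuation m) (dump_division m)"
  unfolding envy_free_def
proof (intro allI impI)
  fix i j
  assume ij: "i < 40 * M + m" "j < 40 * M + m"
  show "util (dump_valuation m) (dump_division m) i j \<le> util (dump_valuation m) (dump_division m) i i"
    unfolding util_dump[OF division_dump ij] util_dump[OF division_dump ij(1) ij(1)] dump_division_scaled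
    using home_envy_free[OF ij] total_pos[OF ij(1)] by (intro divide_right_mono) auto
qed

lemma utilitarian_dump: "real m \<le> utilitarian (40 * M + m) (dump_valuation m) (dump_division m)"
proof -
  have "util (dump_valuation m) (dump_division m) i i = 1" if i: "i \<in> {40 * M..<40 * M + m}" for i
  proof -
    define a where "a = 41 * real M + real ((i - 40 * M) * m)"
    have "player_cdf m i = ramp a (a + real m)"
      using i by (auto simp: player_cdf_def Let_def fun_eq_iff a_def simp flip: M_eq)
    then show ?thesis
      using i m0 home_reserved(1,2)[of i] player_cdf_total(3)[OF M_eq, of i]
      by (simp add: util_dump[OF division_dump] dump_division_scaled ramp_def clip_def a_def)
  qed
  then have "real m = (\<Sum>i=40 * M..<40 * M + m. util (dump_valuation m) (dump_division m) i i)"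
    by simp
  also have "\<dots> \<le> utilitarian (40 * M + m) (dump_valuation m) (dump_division m)"
    unfolding utilitarian_def by (intro sum_mono2) (auto simp: util_def)
  finally show ?thesis .
qed

end

section \<open>The ratio for the instance and the two constants\<close>

lemma utilitarian_dumping_dump:
  assumes "804 \<le> m"
  shows "utilitarian_dumping (40 * (m * m) + m) (dump_valuation m) (real m / 803)"
  unfolding utilitarian_dumping_def
proof (intro conjI exI allI impI)
  \<comment> \<open>This is where \<open>m \<ge> 804\<close> enters: the partial welfare
    \<open>m\<close> must exceed the bound 803.\<close>
  show "1 < real m / 803"
    using assms by simp
  show "partial_div (40 * (m * m) + m) (dump_division m)"
    "envy_free (40 * (m * m) + m) (dump_valuation m) (dump_division m)"
    using assms by (auto intro!: partial_div_dump envy_free_dump)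
  fix x
  assume "complete_div (40 * (m * m) + m) x \<and> envy_free (40 * (m * m) + m) (dump_valuation m) x"
  then have "utilitarian (40 * (m * m) + m) (dump_valuation m) x \<le> 803"
    using assms by (intro complete_welfare_le) auto
  then have "real m / 803 * utilitarian (40 * (m * m) + m) (dump_valuation m) x \<le> real m / 803 * 803"
    by (intro mult_left_mono) auto
  also have "\<dots> \<le> utilitarian (40 * (m * m) + m) (dump_valuation m) (dump_division m)"
    using utilitarian_dump[of m "m * m"] assms by simp
  finally show "real m / 803 * utilitarian (40 * (m * m) + m) (dump_valuation m) x
      \<le> utilitarian (40 * (m * m) + m) (dump_valuation m) (dump_division m)" .
qed

lemma sqrt_players_le: "sqrt (real (40 * (m * m) + m)) \<le> 7 * real m"
proof (rule real_le_lsqrt)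
  have "40 * (m * m) + m \<le> 49 * (m * m)"
    by (cases m) auto
  then have "real (40 * (m * m) + m) \<le> real (49 * (m * m))"
    by (rule of_nat_mono)
  then show "real (40 * (m * m) + m) \<le> (7 * real m)\<^sup>2"
    by (simp add: power2_eq_square)
qed auto

theorem theorem1:
  shows "\<exists>c C::real. 0 < c \<and> c \<le> C \<and>
     infinite {n::nat. \<exists>v \<alpha>. cake_instance n v \<and> utilitarian_dumping n v \<alpha> \<and> \<alpha> \<ge> c * sqrt (real n)} \<and>
     (\<forall>n::nat. \<forall>v \<alpha>. n \<ge> 1 \<and> cake_instance n v \<and> utilitarian_dumping n v \<alpha> \<longrightarrow> \<alpha> \<le> C * sqrt (real n))"
\<comment> \<open>\<open>5621 = 7 * 803\<close>: the instance has ratio \<open>m / 803\<close>, and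
  the root of its number of players is at most \<open>7 * m\<close>.\<close>
proof (rule exI[of _ "1 / 5621"], rule exI[of _ "sqrt 2"], intro conjI allI impI)
  show "1 / 5621 \<le> sqrt (2::real)"
    using real_sqrt_ge_1_iff[of 2] by linarith
  let ?S = "{n::nat. \<exists>v \<alpha>. cake_instance n v \<and> utilitarian_dumping n v \<alpha> \<and> \<alpha> \<ge> 1 / 5621 * sqrt (real n)}"
  have mem: "40 * (m * m) + m \<in> ?S" if "804 \<le> m" for m
  proof -
    have "1 / 5621 * sqrt (real (40 * (m * m) + m)) \<le> real m / 803"
      using sqrt_players_le[of m] by linarith
    moreover have "cake_instance (40 * (m * m) + m) (dump_valuation m)"
      using that by (intro cake_instance_dump) auto
    ultimately show ?thesis
      using utilitarian_dumping_dump[OF that] by blast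
  qed
  have "k < 40 * ((804 + k) * (804 + k)) + (804 + k)" for k :: nat
    by simp
  then have "\<forall>k. \<exists>n>k. n \<in> ?S"
    using mem[OF le_add1] by blast
  then show "infinite ?S"
    unfolding infinite_nat_iff_unbounded .
qed (use utilitarian_dumping_le in auto)

end
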